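(* Let $\Gamma_0$ be the two-generator Schottky group acting on the Poincaré disc $B^2$ described in the context. There are uncountably many limit points of $\Gamma_0$ which are not concentration points for $\Gamma_0$.
   Context: The group $\Gamma_0$: work in the Poincaré unit disc $B^2\subset\mathbf{C}$ with circle at infinity $S^1=\partial B^2$. Let $a,a'$ be two geodesics of $B^2$ which are arcs of Euclidean circles with centers on the real axis, one on each side of the origin, and let $b,b'$ be two geodesics which are arcs of Euclidean circles with centers on the imaginary axis, one on each side of the origin, such that the closures of the four geodesics in $B^2\cup S^1$ are pairwise disjoint, and the region of $B^2$ containing the origin and bounded by these four geodesics has all four of them as its frontier. $\Gamma_0$ is the group generated by two (orientation-preserving, hyperbolic) isometries of $B^2$, one of which preserves the real axis and carries $a'$ to $a$, and the other of which preserves the imaginary axis and carries $b'$ to $b$; the region bounded by $a,a',b,b'$ is a fundamental domain for the action of $\Gamma_0$ on $B^2$. The limit set of $\Gamma_0$ is a Cantor set in $S^1$. Definitions, for a discrete group $\Gamma$ of Möbius transformations of $B^2$ acting on $S^1$ (neighborhoods are open subsets of $S^1$): An open set $U\subseteq S^1$ can be concentrated at $p\in S^1$ if for every neighborhood $V$ of $p$ there exists $\gamma\in\Gamma$ such that $p\in\gamma(U)$ and $\gamma(U)\subseteq V$. A limit point $p$ is a concentration point for $\Gamma$ if every sufficiently small connected neighborhood of $p$ can be concentrated at $p$ (i.e. there is a neighborhood $W$ of $p$ such that every connected neighborhood $U\subseteq W$ of $p$ can be concentrated at $p$). *)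

theory Defs
  imports
    "HOL-Complex_Analysis.Complex_Analysis"
    "HOL-Algebra.Bij"
    "HOL-Algebra.Generated_Groups"
begin

text \<open>
  The disc $B^2$ is \<^term>\<open>ball 0 1 :: complex set\<close>, the circle at infinity $S^1$ is
  \<^term>\<open>sphere 0 1 :: complex set\<close>.
\<close>

text \<open>
  For \<open>norm c > 1\<close>, the Euclidean circle with center \<open>c\<close> and radius \<open>r\<close> is orthogonal to the unit
  circle iff \<open>r\<^sup>2 = (norm c)\<^sup>2 - 1\<close>; its arc inside the disc is then a hyperbolic geodesic.
\<close>

definition geodesic_arc :: "complex \<Rightarrow> complex set" where
  "geodesic_arc c = sphere c (sqrt ((norm c)\<^sup>2 - 1)) \<inter> ball 0 1"

text \<open>
  The orientation-preserving isometries of the Poincare disc, extended to the closed disc.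
  They are made undefined outside the closed disc so that they are elements of
  \<^term>\<open>BijGroup (cball 0 1 :: complex set)\<close>; this also avoids the pole, where the total function
  \<^const>\<open>Moebius_function\<close> takes a dummy value.
\<close>

definition disc_moebius :: "(complex \<Rightarrow> complex) set" where
  "disc_moebius = {restrict (Moebius_function t w) (cball 0 1) | t w. norm w < 1}"

definition hyperbolic :: "(complex \<Rightarrow> complex) \<Rightarrow> bool" where
  "hyperbolic f \<longleftrightarrow> f \<in> disc_moebius \<and>
     (\<forall>z \<in> ball 0 1. f z \<noteq> z) \<and> card {z \<in> sphere 0 1. f z = z} = 2"

text \<open>Accumulation points on the circle of orbits of points of the disc.\<close>

definition limit_set :: "(complex \<Rightarrow> complex) set \<Rightarrow> complex set" where
  "limit_set \<Gamma> = {p \<in> sphere 0 1. \<exists>z \<in> ball 0 1. p islimpt (\<lambda>\<gamma>. \<gamma> z) ` \<Gamma>}"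

abbreviation open_in_circle :: "complex set \<Rightarrow> bool" where
  "open_in_circle U \<equiv> openin (top_of_set (sphere 0 1)) U"

definition can_be_concentrated_at ::
    "(complex \<Rightarrow> complex) set \<Rightarrow> complex set \<Rightarrow> complex \<Rightarrow> bool" where
  "can_be_concentrated_at \<Gamma> U p \<longleftrightarrow>
     (\<forall>V. open_in_circle V \<and> p \<in> V \<longrightarrow> (\<exists>\<gamma>\<in>\<Gamma>. p \<in> \<gamma> ` U \<and> \<gamma> ` U \<subseteq> V))"

definition concentration_point :: "(complex \<Rightarrow> complex) set \<Rightarrow> complex \<Rightarrow> bool" where
  "concentration_point \<Gamma> p \<longleftrightarrow> p \<in> limit_set \<Gamma> \<and>
     (\<exists>W. open_in_circle W \<and> p \<in> W \<and>
        (\<forall>U. open_in_circle U \<and> connected U \<and> p \<in> U \<and> U \<subseteq> W \<longrightarrow>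
             can_be_concentrated_at \<Gamma> U p))"

end

theory Submission
  imports Defs
begin

text \<open>
  Write $g$ and $h$ for the two generators.  The hypotheses force each of them to be a translation
  along its diameter that carries one geodesic to the other, the outside of the first to the inside
  of the second (lemmas \<open>hyperbolic_preserving_diameter\<close>, \<open>pairing_factor_negative\<close>).  The four
  half-discs cut off by the geodesics are disjoint, so that the group plays ping-pong with them: a
  letter $c$ maps every half-disc except that of $c^{-1}$ into the half-disc of $c$.  Hence an infinite
  reduced word $x_0 x_1 x_2 \<dots>$ determines a point $p$ of the circle, the one with
  $(x_0 \<dots> x_{j-1})^{-1} p$ in the half-disc of $x_j$ for every $j$.

  Points that are not concentration points arise from the words
  $g^{n_0} h g^{n_1} h g^{n_2} h \<dots>$ with exponents tending to infinity.  Think of the ray that runs to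
  $p$ in the Cayley tree of the free group, embedded in the disc.  If $\<gamma>(U)$ is a tiny arc
  around $p$, then $\<gamma>^{-1}$ of the ray enters $U$ from outside.  Choose $U$ as follows: along a block
  $g^N$ between two letters $h$ of the word of $p$, cross the ray by a curve that starts between the
  subtrees of $g^{-1}$ and $h^{-1}$ at the first vertex of the block, follows the block, and ends between
  the subtrees of $g$ and $h$ at its last vertex.  In coordinates where the block starts at the origin,
  the far side of the curve is the arc \<open>barrier N\<close>.  The tree is planar and the word is positive, so a translate of the ray can enter this arc only
  while reading a subword $h g^m h$ with $m \<le> N$; see \<open>branch_crossing_barrier\<close> and
  \<open>barrier_imp_turn\<close>.  The exponents tend to infinity, therefore this happens at finitely many places
  only (\<open>finitely_many_crossings\<close>), and finitely many images of a fixed arc cannot shrink to $p$.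

  It remains to know that such arcs $U$ exist in every neighbourhood of $p$.  The prefix of the word
  before the block ends with $h$, and for suitable long prefixes it carries every barrier into a
  small neighbourhood of $p$: its inverse moves $0$ into the half-disc of $h^{-1}$, which is at a
  positive distance from all barriers, and the images of $0$ under the prefixes come arbitrarily close
  to the circle, because distinct prefixes keep them apart (\<open>hull_shrinks\<close>,
  \<open>orbit_approaches_circle\<close>).  Different words give different points, and the set of positions of
  $h$ can be chosen in uncountably many ways (\<open>uncountable_follows\<close>).
\<close>

section \<open>Ping-pong and infinite words\<close>

text \<open>
  The maps $\<phi>_c$ are only required to act on the set \<open>X\<close>.  Outside it they may be arbitrary, as is the
  case for fractional linear maps at their poles; equalities of group elements are therefore stated
  pointwise on \<open>X\<close>.
\<close>

locale ping_pong =
  fixes X :: "'a set" and opp :: "'l \<Rightarrow> 'l" and \<phi> :: "'l \<Rightarrow> 'a \<Rightarrow> 'a" and D :: "'l \<Rightarrow> 'a set"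
  assumes opp_opp [simp]: "opp (opp c) = c"
    and maps_to: "z \<in> X \<Longrightarrow> \<phi> c z \<in> X"
    and opp_inverse: "z \<in> X \<Longrightarrow> \<phi> (opp c) (\<phi> c z) = z"
    and D_subset: "D c \<subseteq> X"
    and D_disjoint: "c \<noteq> d \<Longrightarrow> D c \<inter> D d = {}"
    and ping: "d \<noteq> opp c \<Longrightarrow> z \<in> D d \<Longrightarrow> \<phi> c z \<in> D c"
begin

lemma opp_inverse': "z \<in> X \<Longrightarrow> \<phi> c (\<phi> (opp c) z) = z"
  using opp_inverse[of z "opp c"] by simp

definition reduced :: "(nat \<Rightarrow> 'l) \<Rightarrow> bool" where
  "reduced x \<longleftrightarrow> (\<forall>j. x (Suc j) \<noteq> opp (x j))"

text \<open>
  The role of the points outside all closed half-discs (lemma \<open>exterior_iff\<close>), described by the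
  property that starts the ping-pong.
\<close>
definition exterior :: "'a set" where
  "exterior = {z \<in> X. \<forall>c. \<phi> c z \<in> D c}"

inductive_set words :: "('a \<Rightarrow> 'a) set" where
  empty: "id \<in> words"
| letter: "f \<in> words \<Longrightarrow> \<phi> c \<circ> f \<in> words"

lemma letter_words: "\<phi> c \<in> words"
  using words.letter[OF words.empty, of c] by simp

lemma comp_words: "f \<in> words \<Longrightarrow> f' \<in> words \<Longrightarrow> f \<circ> f' \<in> words"
  by (induction rule: words.induct) (auto simp: comp_assoc intro: words.letter)

lemma words_maps_to: "f \<in> words \<Longrightarrow> z \<in> X \<Longrightarrow> f z \<in> X"
  by (induction rule: words.induct) (auto intro: maps_to)

lemma words_inverse:
  assumes "f \<in> words"
  shows "\<exists>f' \<in> words. \<forall>z\<in>X. f' (f z) = z \<and> f (f' z) = z"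
  using assms
proof (induction rule: words.induct)
  case empty
  then show ?case by (intro bexI[OF _ words.empty]) auto
next
  case (letter f c)
  then obtain f' where f': "f' \<in> words" "\<forall>z\<in>X. f' (f z) = z \<and> f (f' z) = z" by blast
  have "f' \<circ> \<phi> (opp c) \<in> words"
    using f'(1) letter_words comp_words by blast
  moreover have "\<forall>z\<in>X. (f' \<circ> \<phi> (opp c)) ((\<phi> c \<circ> f) z) = z \<and> (\<phi> c \<circ> f) ((f' \<circ> \<phi> (opp c)) z) = z"
    using f' letter.hyps by (auto simp: opp_inverse opp_inverse' words_maps_to maps_to)
  ultimately show ?case by blast
qed

primrec fwd :: "(nat \<Rightarrow> 'l) \<Rightarrow> nat \<Rightarrow> 'a \<Rightarrow> 'a" where
  "fwd x 0 = id"
| "fwd x (Suc m) = fwd x m \<circ> \<phi> (x m)"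

primrec bwd :: "(nat \<Rightarrow> 'l) \<Rightarrow> nat \<Rightarrow> 'a \<Rightarrow> 'a" where
  "bwd x 0 = id"
| "bwd x (Suc m) = \<phi> (opp (x m)) \<circ> bwd x m"

lemma fwd_words: "fwd x m \<in> words"
  by (induction m) (simp_all only: fwd.simps words.empty comp_words letter_words)

lemma bwd_words: "bwd x m \<in> words"
  by (induction m) (simp_all only: bwd.simps words.intros)

lemma fwd_X: "z \<in> X \<Longrightarrow> fwd x m z \<in> X"
  using words_maps_to fwd_words by blast

lemma bwd_X: "z \<in> X \<Longrightarrow> bwd x m z \<in> X"
  using words_maps_to bwd_words by blast

lemma bwd_fwd: "z \<in> X \<Longrightarrow> bwd x m (fwd x m z) = z"
  by (induction m arbitrary: z) (auto simp: opp_inverse maps_to)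

lemma fwd_bwd: "z \<in> X \<Longrightarrow> fwd x m (bwd x m z) = z"
  by (induction m arbitrary: z) (auto simp: opp_inverse' bwd_X)

lemma bwd_step: "z \<in> X \<Longrightarrow> bwd x m z = \<phi> (x m) (bwd x (Suc m) z)"
  by (simp add: opp_inverse' bwd_X)

lemma fwd_add: "fwd x (m + n) = fwd x m \<circ> fwd (\<lambda>i. x (m + i)) n"
  by (induction n) (auto simp: comp_assoc)

text \<open>
  Reading the word from its first letter, every letter maps the half-disc of its successor into its
  own, because the word is reduced.
\<close>
lemma fwd_exterior:
  assumes red: "reduced x" and r: "r \<in> exterior" and "0 < m"
  shows "fwd x m r \<in> D (x 0)"
  using \<open>0 < m\<close> red
proof (induction m arbitrary: x)
  case (Suc m)
  have "fwd x (Suc m) = fwd x (1 + m)" by simp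
  also have "\<dots> = \<phi> (x 0) \<circ> fwd (\<lambda>i. x (1 + i)) m"
    by (subst fwd_add) simp
  finally have eq: "fwd x (Suc m) r = \<phi> (x 0) (fwd (\<lambda>i. x (1 + i)) m r)" by simp
  show ?case
  proof (cases "m = 0")
    case True
    then show ?thesis using r by (auto simp: exterior_def)
  next
    case False
    then have "fwd (\<lambda>i. x (1 + i)) m r \<in> D (x (1 + 0))"
      using Suc.IH[of "\<lambda>i. x (1 + i)"] Suc.prems by (simp add: reduced_def)
    then show ?thesis unfolding eq using Suc.prems(2) by (intro ping) (auto simp: reduced_def)
  qed
qed simp

lemma bwd_exterior:
  assumes red: "reduced x" and r: "r \<in> exterior"
  shows "bwd x (Suc m) r \<in> D (opp (x m))"
proof (induction m)
  case 0
  then show ?case using r by (auto simp: exterior_def)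
next
  case (Suc m)
  have "opp (x m) \<noteq> opp (opp (x (Suc m)))"
    using red opp_opp unfolding reduced_def by metis
  then show ?case using ping Suc by simp
qed

text \<open>
  The point \<open>p\<close> has the word \<open>x\<close> as its itinerary: removing the first \<open>j\<close> letters leaves a
  point in the half-disc of the next one.
\<close>
definition follows :: "(nat \<Rightarrow> 'l) \<Rightarrow> 'a \<Rightarrow> bool" where
  "follows x p \<longleftrightarrow> p \<in> X \<and> (\<forall>j. bwd x j p \<in> D (x j))"

lemma follows_inj:
  assumes "follows x p" "follows y p"
  shows "x = y"
proof
  fix n show "x n = y n"
  proof (induction n rule: less_induct)
    case (less n)
    have "bwd x m = bwd y m" if "m \<le> n" for m
      using that less by (induction m) auto
    then show ?case using assms D_disjoint unfolding follows_def
      by (metis disjoint_iff order_refl)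
  qed
qed

text \<open>
  The group elements other than the inverses of prefixes of \<open>x\<close>.  They start with the inverse of
  a prefix; the next letter neither removes one more letter of \<open>x\<close> nor restores the last one that was
  removed, and from then on there is no cancellation.  The parameter \<open>c\<close> is the last letter applied.
\<close>
inductive branch :: "(nat \<Rightarrow> 'l) \<Rightarrow> 'l \<Rightarrow> ('a \<Rightarrow> 'a) \<Rightarrow> bool" for x where
  leave: "\<lbrakk>c \<noteq> opp (x j); \<And>i. j = Suc i \<Longrightarrow> c \<noteq> x i\<rbrakk> \<Longrightarrow> branch x c (\<phi> c \<circ> bwd x j)"
| extend: "\<lbrakk>branch x d \<delta>; c \<noteq> opp d\<rbrakk> \<Longrightarrow> branch x c (\<phi> c \<circ> \<delta>)"

lemma branch_words: "branch x c \<delta> \<Longrightarrow> \<delta> \<in> words"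
  by (induction rule: branch.induct) (simp_all only: words.letter bwd_words)

text \<open>
  The normal form of a group element relative to an infinite word: cancel as much as possible
  against it.  Both alternatives together are closed under multiplication by a letter from the left.
\<close>
lemma words_cases_along:
  assumes "f \<in> words"
  obtains (along) j where "\<forall>z\<in>X. f z = bwd x j z"
  | (branch) c \<delta> where "branch x c \<delta>" "\<forall>z\<in>X. f z = \<delta> z"
proof -
  have "(\<exists>j. \<forall>z\<in>X. f z = bwd x j z) \<or> (\<exists>c \<delta>. branch x c \<delta> \<and> (\<forall>z\<in>X. f z = \<delta> z))"
    using assms
  proof (induction rule: words.induct)
    case empty
    have "\<forall>z\<in>X. id z = bwd x 0 z" by simp
    then show ?case by blast
  next
    case (letter f c)
    have along: ?case if f: "\<forall>z\<in>X. f z = bwd x j z" for j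
    proof (cases "c = opp (x j)")
      case True
      then have "\<forall>z\<in>X. (\<phi> c \<circ> f) z = bwd x (Suc j) z" using f by simp
      then show ?thesis by blast
    next
      case c: False
      show ?thesis
      proof (cases "\<exists>i. j = Suc i \<and> c = x i")
        case True
        then obtain i where i: "j = Suc i" "c = x i" by blast
        then have "\<forall>z\<in>X. (\<phi> c \<circ> f) z = bwd x i z" using f by (auto simp: opp_inverse' bwd_X)
        then show ?thesis by blast
      next
        case False
        then have "branch x c (\<phi> c \<circ> bwd x j)" using c by (intro leave) auto
        moreover have "\<forall>z\<in>X. (\<phi> c \<circ> f) z = (\<phi> c \<circ> bwd x j) z" using f by auto
        ultimately show ?thesis by blast
      qed
    qed
    from letter.IH show ?case
    proof (elim disjE exE conjE)
      fix d \<delta> assume d: "branch x d \<delta>" and f: "\<forall>z\<in>X. f z = \<delta> z"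
      show ?case
      proof (cases "c = opp d")
        case False
        have "\<forall>z\<in>X. (\<phi> c \<circ> f) z = (\<phi> c \<circ> \<delta>) z" using f by auto
        then show ?thesis using extend[OF d False] by blast
      next
        case c: True
        from d show ?thesis
        proof cases
          case (leave j)
          have "\<forall>z\<in>X. (\<phi> c \<circ> f) z = bwd x j z"
            using f c leave by (auto simp: opp_inverse bwd_X)
          then show ?thesis by blast
        next
          case (extend e \<delta>')
          have "\<forall>z\<in>X. (\<phi> c \<circ> f) z = \<delta>' z"
            using f c extend branch_words[OF extend(2)] by (auto simp: opp_inverse words_maps_to)
          then show ?thesis using extend(2) by blast
        qed
      qed
    qed (use along in blast)
  qed
  then show ?thesis using that by blast
qed

text \<open>
  Once a group element has left the itinerary of \<open>p\<close>, nothing separates the images of \<open>p\<close> and \<open>r\<close>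
  any more: by ping-pong, the last letter applied collects both in its half-disc.
\<close>
lemma branch_cylinder:
  assumes "branch x c \<delta>" and red: "reduced x"
    and p: "follows x p" and r: "r \<in> exterior"
  shows "\<delta> p \<in> D c \<and> \<delta> r \<in> D c"
  using assms(1)
proof (induction rule: branch.induct)
  case (leave c j)
  have "\<phi> c (bwd x j p) \<in> D c"
    using p leave unfolding follows_def by (intro ping[of "x j"]) (auto simp: opp_opp)
  moreover have "\<phi> c (bwd x j r) \<in> D c"
  proof (cases j)
    case 0
    then show ?thesis using r by (auto simp: exterior_def)
  next
    case (Suc i)
    then have "opp (x i) \<noteq> opp c" using leave(2) opp_opp by metis
    then show ?thesis unfolding Suc using bwd_exterior[OF red r] by (intro ping)
  qed
  ultimately show ?case by simp
next
  case (extend d \<delta> c)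
  have "d \<noteq> opp c" using extend(2) by auto
  then show ?case using extend ping by auto
qed

end

section \<open>Moebius transformations of the closed disc\<close>

text \<open>
  The action of $SU(1,1)$.  In this form, closure under composition is matrix multiplication, and
  all metric information is in the denominator.
\<close>
definition unit_disc_moebius :: "(complex \<Rightarrow> complex) \<Rightarrow> bool" where
  "unit_disc_moebius f \<longleftrightarrow> (\<exists>\<alpha> \<beta>. (norm \<alpha>)\<^sup>2 - (norm \<beta>)\<^sup>2 = 1 \<and>
     (\<forall>z\<in>cball 0 1. f z = (\<alpha> * z + \<beta>) / (cnj \<beta> * z + cnj \<alpha>)))"

lemma denominator_nonzero:
  fixes \<alpha> \<beta> z :: complex
  assumes "(norm \<alpha>)\<^sup>2 - (norm \<beta>)\<^sup>2 = 1" "norm z \<le> 1"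
  shows "cnj \<beta> * z + cnj \<alpha> \<noteq> 0"
proof
  assume "cnj \<beta> * z + cnj \<alpha> = 0"
  then have "cnj \<alpha> = - (cnj \<beta> * z)" by (simp add: add_eq_0_iff)
  then have "norm \<alpha> = norm \<beta> * norm z" by (metis complex_mod_cnj norm_minus_cancel norm_mult)
  also have "\<dots> \<le> norm \<beta>" using assms(2) by (simp add: mult_left_le)
  finally have "(norm \<alpha>)\<^sup>2 \<le> (norm \<beta>)\<^sup>2" by (intro power_mono) auto
  then show False using assms(1) by linarith
qed

lemma norm_denominator_minus_numerator:
  fixes \<alpha> \<beta> z :: complex
  assumes "(norm \<alpha>)\<^sup>2 - (norm \<beta>)\<^sup>2 = 1"
  shows "(norm (cnj \<beta> * z + cnj \<alpha>))\<^sup>2 - (norm (\<alpha> * z + \<beta>))\<^sup>2 = 1 - (norm z)\<^sup>2"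
proof -
  have "(norm (cnj \<beta> * z + cnj \<alpha>))\<^sup>2 - (norm (\<alpha> * z + \<beta>))\<^sup>2 =
      ((norm \<alpha>)\<^sup>2 - (norm \<beta>)\<^sup>2) * (1 - (norm z)\<^sup>2)"
    unfolding cmod_power2 by (simp add: power2_eq_square algebra_simps)
  then show ?thesis using assms by simp
qed

lemma one_minus_norm_moebius:
  fixes \<alpha> \<beta> z :: complex
  assumes "(norm \<alpha>)\<^sup>2 - (norm \<beta>)\<^sup>2 = 1" "norm z \<le> 1"
  shows "1 - (norm ((\<alpha> * z + \<beta>) / (cnj \<beta> * z + cnj \<alpha>)))\<^sup>2 =
    (1 - (norm z)\<^sup>2) / (norm (cnj \<beta> * z + cnj \<alpha>))\<^sup>2"
  using norm_denominator_minus_numerator[OF assms(1), of z] denominator_nonzero[OF assms]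
  by (simp add: norm_divide power_divide field_simps)

lemma unit_disc_moebius_norm:
  assumes "unit_disc_moebius f"
  shows "norm z \<le> 1 \<Longrightarrow> norm (f z) \<le> 1" "norm z = 1 \<Longrightarrow> norm (f z) = 1"
    "norm z < 1 \<Longrightarrow> norm (f z) < 1"
proof -
  obtain \<alpha> \<beta> where ab: "(norm \<alpha>)\<^sup>2 - (norm \<beta>)\<^sup>2 = 1"
    and f: "\<And>z. norm z \<le> 1 \<Longrightarrow> f z = (\<alpha> * z + \<beta>) / (cnj \<beta> * z + cnj \<alpha>)"
    using assms unfolding unit_disc_moebius_def by auto
  have eq: "1 - (norm (f z))\<^sup>2 = (1 - (norm z)\<^sup>2) / (norm (cnj \<beta> * z + cnj \<alpha>))\<^sup>2" 
    and pos: "0 < (norm (cnj \<beta> * z + cnj \<alpha>))\<^sup>2" if "norm z \<le> 1"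
    using one_minus_norm_moebius[OF ab that] denominator_nonzero[OF ab that] f[OF that] by simp_all
  show "norm (f z) \<le> 1" if z: "norm z \<le> 1"
  proof -
    have "0 \<le> 1 - (norm (f z))\<^sup>2"
      unfolding eq[OF z] using z by (simp add: power_le_one)
    then show ?thesis by (simp add: abs_square_le_1)
  qed
  show "norm (f z) = 1" if z: "norm z = 1"
  proof -
    have "(norm (f z))\<^sup>2 = 1" using eq z by simp
    then show ?thesis by (simp add: power2_eq_1_iff) (use norm_ge_zero[of "f z"] in linarith)
  qed
  show "norm (f z) < 1" if z: "norm z < 1"
  proof -
    have "0 < 1 - (norm (f z))\<^sup>2"
      using eq pos z by (simp add: power_less_one_iff)
    then show ?thesis by (simp add: abs_square_less_1)
  qed
qed

lemma unit_disc_moebius_id: "unit_disc_moebius id"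
  unfolding unit_disc_moebius_def by (intro exI[of _ 1] exI[of _ 0]) auto

lemma unit_disc_moebius_comp:
  assumes "unit_disc_moebius f" "unit_disc_moebius f'"
  shows "unit_disc_moebius (f \<circ> f')"
proof -
  obtain \<alpha> \<beta> where ab: "(norm \<alpha>)\<^sup>2 - (norm \<beta>)\<^sup>2 = 1"
    and f: "\<And>z. norm z \<le> 1 \<Longrightarrow> f z = (\<alpha> * z + \<beta>) / (cnj \<beta> * z + cnj \<alpha>)"
    using assms(1) unfolding unit_disc_moebius_def by auto
  obtain \<alpha>' \<beta>' where ab': "(norm \<alpha>')\<^sup>2 - (norm \<beta>')\<^sup>2 = 1"
    and f': "\<And>z. norm z \<le> 1 \<Longrightarrow> f' z = (\<alpha>' * z + \<beta>') / (cnj \<beta>' * z + cnj \<alpha>')"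
    using assms(2) unfolding unit_disc_moebius_def by auto
  define A where "A = \<alpha> * \<alpha>' + \<beta> * cnj \<beta>'"
  define B where "B = \<alpha> * \<beta>' + \<beta> * cnj \<alpha>'"
  have "(norm A)\<^sup>2 - (norm B)\<^sup>2 = ((norm \<alpha>)\<^sup>2 - (norm \<beta>)\<^sup>2) * ((norm \<alpha>')\<^sup>2 - (norm \<beta>')\<^sup>2)"
    unfolding A_def B_def cmod_power2 by (simp add: power2_eq_square algebra_simps)
  moreover have "(f \<circ> f') z = (A * z + B) / (cnj B * z + cnj A)" if z: "norm z \<le> 1" for z
  proof -
    define e where "e = cnj \<beta>' * z + cnj \<alpha>'"
    have e: "e \<noteq> 0" unfolding e_def using denominator_nonzero[OF ab' z] .
    have fe: "f' z * e = \<alpha>' * z + \<beta>'" using f'[OF z] e unfolding e_def by simp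
    have "norm (f' z) \<le> 1" using unit_disc_moebius_norm(1)[OF assms(2)] z by simp
    then have "(f \<circ> f') z = (\<alpha> * f' z + \<beta>) / (cnj \<beta> * f' z + cnj \<alpha>)" using f by simp
    also have "\<dots> = ((\<alpha> * f' z + \<beta>) * e) / ((cnj \<beta> * f' z + cnj \<alpha>) * e)" using e by simp
    also have "(\<alpha> * f' z + \<beta>) * e = A * z + B"
      unfolding distrib_right mult.assoc[of _ "f' z"] fe by (simp add: e_def A_def B_def algebra_simps)
    also have "(cnj \<beta> * f' z + cnj \<alpha>) * e = cnj B * z + cnj A"
      unfolding distrib_right mult.assoc[of _ "f' z"] fe by (simp add: e_def A_def B_def algebra_simps)
    finally show ?thesis .
  qed
  ultimately show ?thesis unfolding unit_disc_moebius_def using ab ab' by (intro exI[of _ A] exI[of _ B]) auto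
qed

lemma unit_disc_moebius_dist:
  assumes "unit_disc_moebius f"
  obtains \<alpha> \<beta> where "(norm \<alpha>)\<^sup>2 - (norm \<beta>)\<^sup>2 = 1"
    "\<And>z. norm z \<le> 1 \<Longrightarrow> f z = (\<alpha> * z + \<beta>) / (cnj \<beta> * z + cnj \<alpha>)"
    "1 - (norm (f 0))\<^sup>2 = 1 / (norm \<alpha>)\<^sup>2" "\<alpha> \<noteq> 0"
    "\<And>z z'. norm z \<le> 1 \<Longrightarrow> norm z' \<le> 1 \<Longrightarrow>
      norm (f z - f z') = norm (z - z') / (norm (cnj \<beta> * z + cnj \<alpha>) * norm (cnj \<beta> * z' + cnj \<alpha>))"
proof -
  obtain \<alpha> \<beta> where ab: "(norm \<alpha>)\<^sup>2 - (norm \<beta>)\<^sup>2 = 1"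
    and f: "\<And>z. norm z \<le> 1 \<Longrightarrow> f z = (\<alpha> * z + \<beta>) / (cnj \<beta> * z + cnj \<alpha>)"
    using assms unfolding unit_disc_moebius_def by auto
  have ab': "\<alpha> * cnj \<alpha> - \<beta> * cnj \<beta> = 1"
    using ab by (metis complex_norm_square of_real_1 of_real_diff)
  show thesis
  proof (rule that[OF ab f])
    show "1 - (norm (f 0))\<^sup>2 = 1 / (norm \<alpha>)\<^sup>2"
      using one_minus_norm_moebius[OF ab, of 0] f[of 0] by simp
    show "\<alpha> \<noteq> 0" using ab zero_le_power2[of "norm \<beta>"] by (intro notI) simp
    fix z z' :: complex assume z: "norm z \<le> 1" "norm z' \<le> 1"
    note nz = denominator_nonzero[OF ab z(1)] denominator_nonzero[OF ab z(2)]
    have "f z - f z' = ((\<alpha> * z + \<beta>) * (cnj \<beta> * z' + cnj \<alpha>) - (\<alpha> * z' + \<beta>) * (cnj \<beta> * z + cnj \<alpha>)) /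
        ((cnj \<beta> * z + cnj \<alpha>) * (cnj \<beta> * z' + cnj \<alpha>))"
      using nz f z by (simp add: diff_frac_eq)
    also have "(\<alpha> * z + \<beta>) * (cnj \<beta> * z' + cnj \<alpha>) - (\<alpha> * z' + \<beta>) * (cnj \<beta> * z + cnj \<alpha>) =
        (\<alpha> * cnj \<alpha> - \<beta> * cnj \<beta>) * (z - z')"
      by (simp add: algebra_simps)
    finally show "norm (f z - f z') = norm (z - z') / (norm (cnj \<beta> * z + cnj \<alpha>) * norm (cnj \<beta> * z' + cnj \<alpha>))"
      using ab' by (simp add: norm_divide norm_mult)
  qed auto
qed

text \<open>
  Each denominator is at most $2|\<alpha>|$, and $1/|\<alpha>|^2 = 1 - |f(0)|^2$.  As long as $f(0)$ stays away from
  the circle, $f$ cannot bring a point close to $f(0)$ unless it was close to $0$.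
\<close>
lemma unit_disc_moebius_separation:
  assumes "unit_disc_moebius f" "norm z \<le> 1"
  shows "norm z * (1 - (norm (f 0))\<^sup>2) / 2 \<le> norm (f z - f 0)"
proof -
  obtain \<alpha> \<beta> where ab: "(norm \<alpha>)\<^sup>2 - (norm \<beta>)\<^sup>2 = 1"
    and f0: "1 - (norm (f 0))\<^sup>2 = 1 / (norm \<alpha>)\<^sup>2" and a0: "\<alpha> \<noteq> 0"
    and dist: "\<And>z z'. norm z \<le> 1 \<Longrightarrow> norm z' \<le> 1 \<Longrightarrow>
      norm (f z - f z') = norm (z - z') / (norm (cnj \<beta> * z + cnj \<alpha>) * norm (cnj \<beta> * z' + cnj \<alpha>))"
    using unit_disc_moebius_dist[OF assms(1)] by metis
  have "(norm \<beta>)\<^sup>2 \<le> (norm \<alpha>)\<^sup>2" using ab by linarith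
  then have ba: "norm \<beta> \<le> norm \<alpha>" by (rule power2_le_imp_le) simp
  have "norm (cnj \<beta> * z + cnj \<alpha>) \<le> norm \<beta> * norm z + norm \<alpha>"
    using norm_triangle_ineq[of "cnj \<beta> * z" "cnj \<alpha>"] by (simp add: norm_mult)
  also have "\<dots> \<le> 2 * norm \<alpha>" using ba mult_mono[OF ba assms(2)] by simp
  finally have le: "norm (cnj \<beta> * z + cnj \<alpha>) * norm \<alpha> \<le> 2 * (norm \<alpha>)\<^sup>2"
    using mult_right_mono[of _ "2 * norm \<alpha>" "norm \<alpha>"] by (simp add: power2_eq_square mult.assoc)
  have "norm z * (1 - (norm (f 0))\<^sup>2) / 2 = norm z / (2 * (norm \<alpha>)\<^sup>2)" using f0 by simp
  also have "\<dots> \<le> norm z / (norm (cnj \<beta> * z + cnj \<alpha>) * norm \<alpha>)"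
    using le a0 denominator_nonzero[OF ab assms(2)] by (intro divide_left_mono mult_pos_pos) auto
  also have "\<dots> = norm (f z - f 0)" using dist[of z 0] assms(2) by simp
  finally show ?thesis .
qed

text \<open>
  With $w = f^{-1}(0)$ the denominator at $z$ has absolute value \<open>norm \<alpha> * norm (1 - cnj w * z)\<close>.  Thus $f$ contracts
  every set that stays away from $w$, at a rate given by the distance of $f(0)$ to the circle.
\<close>
lemma unit_disc_moebius_contraction:
  assumes f: "unit_disc_moebius f" and w: "norm w < 1" "f w = 0" and "0 < \<eta>"
    and z: "norm z \<le> 1" "norm z' \<le> 1" "\<eta> \<le> norm (1 - cnj w * z)" "\<eta> \<le> norm (1 - cnj w * z')"
  shows "norm (f z - f z') \<le> 2 * (1 - (norm (f 0))\<^sup>2) / \<eta>\<^sup>2"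
proof -
  obtain \<alpha> \<beta> where ab: "(norm \<alpha>)\<^sup>2 - (norm \<beta>)\<^sup>2 = 1"
    and fz: "\<And>z. norm z \<le> 1 \<Longrightarrow> f z = (\<alpha> * z + \<beta>) / (cnj \<beta> * z + cnj \<alpha>)"
    and f0: "1 - (norm (f 0))\<^sup>2 = 1 / (norm \<alpha>)\<^sup>2" and a0: "\<alpha> \<noteq> 0"
    and dist: "\<And>z z'. norm z \<le> 1 \<Longrightarrow> norm z' \<le> 1 \<Longrightarrow>
      norm (f z - f z') = norm (z - z') / (norm (cnj \<beta> * z + cnj \<alpha>) * norm (cnj \<beta> * z' + cnj \<alpha>))"
    using unit_disc_moebius_dist[OF f] by metis
  have "\<alpha> * w + \<beta> = 0"
    using fz[of w] w denominator_nonzero[OF ab, of w] by auto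
  then have "\<beta> = - (\<alpha> * w)" by (simp add: add_eq_0_iff)
  then have den: "norm (cnj \<beta> * z + cnj \<alpha>) = norm \<alpha> * norm (1 - cnj w * z)" for z
  proof -
    have "cnj \<beta> * z + cnj \<alpha> = cnj \<alpha> * (1 - cnj w * z)"
      using \<open>\<beta> = - (\<alpha> * w)\<close> by (simp add: algebra_simps)
    then show ?thesis by (simp add: norm_mult)
  qed
  have "norm (z - z') \<le> 2" using norm_triangle_ineq4[of z z'] z by simp
  have pos: "\<eta>\<^sup>2 \<le> norm (1 - cnj w * z) * norm (1 - cnj w * z')"
    unfolding power2_eq_square using z \<open>0 < \<eta>\<close> by (intro mult_mono) auto
  have "norm (f z - f z') = norm (z - z') / ((norm \<alpha>)\<^sup>2 * (norm (1 - cnj w * z) * norm (1 - cnj w * z')))"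
    using dist[OF z(1,2)] unfolding den by (simp only: power2_eq_square mult_ac)
  also have "\<dots> \<le> 2 / ((norm \<alpha>)\<^sup>2 * \<eta>\<^sup>2)"
    using \<open>norm (z - z') \<le> 2\<close> pos a0 \<open>0 < \<eta>\<close> by (intro frac_le mult_left_mono mult_pos_pos) auto
  also have "\<dots> = 2 * (1 - (norm (f 0))\<^sup>2) / \<eta>\<^sup>2" using f0 by simp
  finally show ?thesis .
qed

lemma unit_disc_moebius_continuous:
  assumes "unit_disc_moebius f"
  shows "continuous_on (cball 0 1) f"
proof -
  obtain \<alpha> \<beta> where ab: "(norm \<alpha>)\<^sup>2 - (norm \<beta>)\<^sup>2 = 1"
    and f: "\<forall>z\<in>cball 0 1. f z = (\<alpha> * z + \<beta>) / (cnj \<beta> * z + cnj \<alpha>)"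
    using assms unfolding unit_disc_moebius_def by auto
  have "continuous_on (cball 0 1) (\<lambda>z. (\<alpha> * z + \<beta>) / (cnj \<beta> * z + cnj \<alpha>))"
    using denominator_nonzero[OF ab] by (intro continuous_intros) auto
  then show ?thesis using f by (metis (no_types, lifting) continuous_on_cong)
qed

text \<open>
  The hyperbolic translation along the diameter through \<open>\<beta>\<close> that moves \<open>0\<close> to \<open>\<beta>\<close>.
\<close>
definition translation :: "complex \<Rightarrow> complex \<Rightarrow> complex" where
  "translation \<beta> z = (z + \<beta>) / (1 + cnj \<beta> * z)"

lemma translation_denominator:
  assumes "norm \<beta> < 1" "norm z \<le> 1"
  shows "1 + cnj \<beta> * z \<noteq> 0"
proof
  assume "1 + cnj \<beta> * z = 0"
  then have "cnj \<beta> * z = -1" by (simp add: add_eq_0_iff)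
  then have "norm \<beta> * norm z = 1" by (metis complex_mod_cnj norm_minus_cancel norm_mult norm_one)
  then show False using assms mult_left_le[of "norm z" "norm \<beta>"] by simp
qed

lemma translation_moebius:
  assumes "norm \<beta> < 1"
  shows "unit_disc_moebius (translation \<beta>)"
proof -
  define k where "k = 1 / sqrt (1 - (norm \<beta>)\<^sup>2)"
  have b: "(norm \<beta>)\<^sup>2 < 1" using assms by (simp add: power_less_one_iff)
  have k: "k \<noteq> 0" "k\<^sup>2 * (1 - (norm \<beta>)\<^sup>2) = 1" 
    using b by (auto simp: k_def power_divide)
  have "translation \<beta> z = (of_real k * z + of_real k * \<beta>) / (cnj (of_real k * \<beta>) * z + cnj (of_real k))" for z
  proof -
    have "of_real k * z + of_real k * \<beta> = of_real k * (z + \<beta>)"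
      "cnj (of_real k * \<beta>) * z + cnj (of_real k) = of_real k * (1 + cnj \<beta> * z)"
      by (simp_all add: algebra_simps)
    then show ?thesis unfolding translation_def using k by simp
  qed
  moreover have "(norm (complex_of_real k))\<^sup>2 - (norm (complex_of_real k * \<beta>))\<^sup>2 = 1"
    using k(2) by (simp add: norm_mult power_mult_distrib algebra_simps)
  ultimately show ?thesis unfolding unit_disc_moebius_def by blast
qed

lemma translation_inverse:
  assumes "norm \<beta> < 1" "norm z \<le> 1"
  shows "translation (- \<beta>) (translation \<beta> z) = z"
proof -
  note nz = translation_denominator[OF assms]
  have b: "1 - \<beta> * cnj \<beta> \<noteq> 0"
  proof
    assume "1 - \<beta> * cnj \<beta> = 0"
    then have "norm (\<beta> * cnj \<beta>) = 1" by simp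
    then have "(norm \<beta>)\<^sup>2 = 1" by (simp add: norm_mult power2_eq_square)
    then show False using assms(1) power_less_one_iff[of "norm \<beta>" 2] by simp
  qed
  have n: "translation \<beta> z - \<beta> = z * (1 - \<beta> * cnj \<beta>) / (1 + cnj \<beta> * z)"
    using nz by (simp add: translation_def field_simps)
  have d: "1 - cnj \<beta> * translation \<beta> z = (1 - \<beta> * cnj \<beta>) / (1 + cnj \<beta> * z)"
    using nz by (simp add: translation_def field_simps)
  have "translation (- \<beta>) (translation \<beta> z) = (translation \<beta> z - \<beta>) / (1 - cnj \<beta> * translation \<beta> z)"
    by (simp add: translation_def[of "- \<beta>"])
  then show ?thesis unfolding n d using nz b by simp
qed

section \<open>Geodesics and their half-discs\<close>

text \<open>
  The power of \<open>z\<close> with respect to the circle around \<open>c\<close> that is orthogonal to the unit circle: it is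
  \<open>(dist c z)\<^sup>2 - ((norm c)\<^sup>2 - 1)\<close>, so its sign tells on which side of the geodesic \<open>z\<close> lies.  On the
  unit circle it is affine.
\<close>
definition circle_power :: "complex \<Rightarrow> complex \<Rightarrow> real" where
  "circle_power c z = 1 + (norm z)\<^sup>2 - 2 * Re (cnj c * z)"

lemma geodesic_arc_eq:
  assumes "1 < norm c"
  shows "geodesic_arc c = {z \<in> ball 0 1. circle_power c z = 0}"
proof -
  have "(dist c z)\<^sup>2 = circle_power c z + ((norm c)\<^sup>2 - 1)" for z
    unfolding dist_norm cmod_power2 circle_power_def by (simp add: power2_eq_square algebra_simps)
  then have iff: "(dist c z)\<^sup>2 = (norm c)\<^sup>2 - 1 \<longleftrightarrow> circle_power c z = 0" for z by simp
  have sqrt_iff: "d = sqrt k \<longleftrightarrow> d\<^sup>2 = k" if "0 \<le> d" "0 \<le> k" for d k :: real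
  proof
    assume "d = sqrt k"
    then show "d\<^sup>2 = k" using that(2) by simp
  next
    assume "d\<^sup>2 = k"
    from real_sqrt_unique[OF this that(1)] show "d = sqrt k" by (rule sym)
  qed
  have "0 \<le> (norm c)\<^sup>2 - 1" using assms power_mono[of 1 "norm c" 2] by simp
  then have "dist c z = sqrt ((norm c)\<^sup>2 - 1) \<longleftrightarrow> (dist c z)\<^sup>2 = (norm c)\<^sup>2 - 1" for z
    by (rule sqrt_iff[OF zero_le_dist])
  with iff have "dist c z = sqrt ((norm c)\<^sup>2 - 1) \<longleftrightarrow> circle_power c z = 0" for z by blast
  then show ?thesis
    unfolding geodesic_arc_def set_eq_iff Int_iff mem_sphere mem_Collect_eq by blast
qed

text \<open>
  The chord that joins the endpoints of the geodesic consists of the \<open>v\<close> in the closed disc with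
  \<open>Re (cnj c * v) = 1\<close>.  The factor is the passage from the Klein model, where geodesics are chords,
  to the Poincare model.  Endpoints are reached as limits of points of the open chord.
\<close>
lemma arc_closure_point:
  assumes c: "1 < norm c" and v: "norm v \<le> 1" "Re (cnj c * v) = 1"
  shows "v / of_real (1 + sqrt (1 - (norm v)\<^sup>2)) \<in> closure (geodesic_arc c)"
proof -
  define F :: "complex \<Rightarrow> complex" where "F = (\<lambda>v. v / of_real (1 + sqrt (1 - (norm v)\<^sup>2)))"
  have F: "F y \<in> geodesic_arc c" if y: "norm y < 1" "Re (cnj c * y) = 1" for y
  proof -
    define k where "k = 1 + sqrt (1 - (norm y)\<^sup>2)"
    have y1: "(norm y)\<^sup>2 < 1" using y by (simp add: power_less_one_iff)
    have k1: "k > 1" unfolding k_def using y1 by simp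
    have k: "k\<^sup>2 + (norm y)\<^sup>2 = 2 * k"
      unfolding k_def using y1 by (simp add: power2_eq_square algebra_simps) 
    have Fy: "F y = y / of_real k" by (simp add: F_def k_def)
    have "norm (F y) < 1" unfolding Fy using y k1 by (simp add: norm_divide)
    moreover have "circle_power c (F y) = 0"
    proof -
      have n: "(norm (F y))\<^sup>2 = (norm y)\<^sup>2 / k\<^sup>2" unfolding Fy by (simp add: norm_divide power_divide)
      have r: "Re (cnj c * F y) = 1 / k" unfolding Fy using y(2)
        by (simp only: times_divide_eq_right Re_divide_of_real)
      show ?thesis unfolding circle_power_def n r using k k1
        by (simp add: field_simps power2_eq_square)
    qed
    ultimately show ?thesis using geodesic_arc_eq[OF c] by simp
  qed
  define e where "e = c / of_real ((norm c)\<^sup>2)"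
  have c0: "c \<noteq> 0" using c by auto
  have "cnj c * e = 1" unfolding e_def complex_norm_square using c0 by simp
  then have e: "Re (cnj c * e) = 1" by simp
  have "norm e = norm c / (norm c)\<^sup>2" unfolding e_def norm_divide norm_of_real by simp
  also have "\<dots> = 1 / norm c" using c0 by (simp add: power2_eq_square)
  finally have "norm e = 1 / norm c" .
  then have e1: "norm e < 1" using c c0 by (simp add: divide_less_eq)
  define y where "y = (\<lambda>n. of_real (1 - inverse (real (Suc n))) * v + of_real (inverse (real (Suc n))) * e)"
  have yF: "F (y n) \<in> geodesic_arc c" for n
  proof (rule F)
    define t where "t = inverse (real (Suc n))"
    have t: "0 < t" "t \<le> 1" unfolding t_def by (auto simp: divide_simps)
    have "norm (y n) \<le> norm (of_real (1 - t) * v) + norm (of_real t * e)"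
      unfolding y_def t_def by (rule norm_triangle_ineq)
    also have "\<dots> = (1 - t) * norm v + t * norm e" 
      unfolding norm_mult norm_of_real using t by simp
    also have "\<dots> < (1 - t) * 1 + t * 1" using t v e1 by (intro add_le_less_mono mult_left_mono mult_strict_left_mono) auto
    finally show "norm (y n) < 1" by simp
    have "Re (cnj c * y n) = (1 - t) * Re (cnj c * v) + t * Re (cnj c * e)"
      unfolding y_def t_def[symmetric] by (simp add: algebra_simps)
    then show "Re (cnj c * y n) = 1" using v e by simp
  qed
  have "y \<longlonglongrightarrow> of_real (1 - 0) * v + of_real 0 * e"
    unfolding y_def by (intro tendsto_intros LIMSEQ_inverse_real_of_nat)
  then have "y \<longlonglongrightarrow> v" by simp
  moreover have "isCont F v"
  proof -
    have "1 + sqrt (1 - (norm v)\<^sup>2) > 0" using v power_le_one[of "norm v" 2] by (simp add: add_pos_nonneg)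
    then have "complex_of_real (1 + sqrt (1 - (norm v)\<^sup>2)) \<noteq> 0" by (simp only: of_real_eq_0_iff)
    then show ?thesis unfolding F_def by (intro continuous_intros)
  qed
  ultimately have "(\<lambda>n. F (y n)) \<longlonglongrightarrow> F v" by (rule isCont_tendsto_compose[rotated])
  with yF have "F v \<in> closure (geodesic_arc c)"
    unfolding closure_sequential by (intro exI[of _ "\<lambda>n. F (y n)"] conjI allI)
  then show ?thesis unfolding F_def .
qed

text \<open>
  The intersection of the lines that carry two chords lies outside the closed disc as soon as the
  geodesics have disjoint closures.
\<close>
lemma disjoint_arcs_imp:
  assumes "1 < norm c" "1 < norm d" and disj: "disjnt (closure (geodesic_arc c)) (closure (geodesic_arc d))"
    and v: "Re (cnj c * v) = 1" "Re (cnj d * v) = 1"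
  shows "1 < norm v"
  using arc_closure_point[OF assms(1) _ v(1)] arc_closure_point[OF assms(2) _ v(2)] disj
  unfolding disjnt_iff by (meson not_le)

text \<open>
  For \<open>y \<noteq> 0\<close> the two roots are inverse to each other, so one of them is in the disc.  Such a root
  locates both the fixed point of a half-turn and the point where a geodesic meets its diameter.
\<close>
lemma quadratic_root_in_disc:
  fixes y :: real
  assumes "\<bar>y\<bar> < 1"
  obtains x where "\<bar>x\<bar> < 1" "y * (1 + x\<^sup>2) = 2 * x"
proof -
  define k where "k = 1 + sqrt (1 - y\<^sup>2)"
  have y1: "y\<^sup>2 < 1" using assms by (simp add: abs_square_less_1)
  have k1: "k > 1" unfolding k_def using y1 by simp
  have k: "k\<^sup>2 + y\<^sup>2 = 2 * k"
    unfolding k_def using y1 by (simp add: power2_eq_square algebra_simps)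
  show thesis
  proof (rule that[of "y / k"])
    show "\<bar>y / k\<bar> < 1" using assms k1 by (simp add: abs_divide divide_less_eq)
    have "y * (1 + (y / k)\<^sup>2) = y * (k\<^sup>2 + y\<^sup>2) / k\<^sup>2" using k1 by (simp add: field_simps power_divide)
    also have "\<dots> = 2 * (y / k)" unfolding k using k1 by (simp add: power2_eq_square)
    finally show "y * (1 + (y / k)\<^sup>2) = 2 * (y / k)" .
  qed
qed

text \<open>
  An isometry of the disc that preserves a diameter is a translation along it, possibly followed by
  the half-turn about \<open>0\<close>, or a rotation about \<open>0\<close>.  The last kind and every map with a half-turn
  have a fixed point in the disc, which hyperbolicity excludes.
\<close>
lemma hyperbolic_preserving_diameter:
  assumes f: "hyperbolic f" and \<omega>: "norm \<omega> = 1"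
    and axis: "f ` {z \<in> ball 0 1. Im (cnj \<omega> * z) = 0} = {z \<in> ball 0 1. Im (cnj \<omega> * z) = 0}"
  obtains u :: real where "\<bar>u\<bar> < 1" "\<And>z. z \<in> cball 0 1 \<Longrightarrow> f z = translation (of_real u * \<omega>) z"
proof -
  have ww: "\<omega> * cnj \<omega> = 1" "cnj \<omega> * \<omega> = 1"
    using \<omega> complex_norm_square[of \<omega>] by (simp_all add: mult.commute)
  have on_axis: "\<exists>y::real. z = of_real y * \<omega> \<and> \<bar>y\<bar> < 1" if "norm z < 1" "Im (cnj \<omega> * z) = 0" for z
  proof (intro exI conjI)
    have "cnj \<omega> * z = of_real (Re (cnj \<omega> * z))" using that(2) by (simp add: complex_eq_iff)
    then have "\<omega> * (cnj \<omega> * z) = \<omega> * of_real (Re (cnj \<omega> * z))" by simp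
    then show eq: "z = of_real (Re (cnj \<omega> * z)) * \<omega>" using ww by (simp add: mult.assoc[symmetric] mult.commute)
    have "norm z = \<bar>Re (cnj \<omega> * z)\<bar>" by (subst eq) (simp only: norm_mult norm_of_real \<omega> mult_1_right)
    then show "\<bar>Re (cnj \<omega> * z)\<bar> < 1" using that(1) by simp
  qed
  obtain t w where w: "norm w < 1" and ft: "f = restrict (Moebius_function t w) (cball 0 1)"
    using f unfolding hyperbolic_def disc_moebius_def by blast
  define e where "e = exp (\<i> * of_real t)"
  have e1: "norm e = 1" unfolding e_def by simp
  have fz: "f z = e * (z - w) / (1 - cnj w * z)" if "norm z \<le> 1" for z
    using that unfolding ft e_def by (simp add: Moebius_function_def)
  have nofix: "f z \<noteq> z" if "norm z < 1" for z using f that unfolding hyperbolic_def by simp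
  have "0 \<in> f ` {z \<in> ball 0 1. Im (cnj \<omega> * z) = 0}" unfolding axis by simp
  then obtain z0 where z0: "norm z0 < 1" "Im (cnj \<omega> * z0) = 0" "f z0 = 0" by auto
  have "z0 = w"
  proof -
    have "1 - cnj w * z0 \<noteq> 0" using translation_denominator[of "- w" z0] w z0 by simp
    then show ?thesis using z0 fz[of z0] e1 by auto
  qed
  then obtain y where y: "w = of_real y * \<omega>" "\<bar>y\<bar> < 1" using on_axis[of z0] z0 by blast
  have "f 0 \<in> f ` {z \<in> ball 0 1. Im (cnj \<omega> * z) = 0}" by (rule imageI) simp
  then have "f 0 \<in> {z \<in> ball 0 1. Im (cnj \<omega> * z) = 0}" unfolding axis .
  then obtain x where x: "f 0 = of_real x * \<omega>" using on_axis by auto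
  have y0: "y \<noteq> 0" using fz[of 0] nofix[of 0] y(1) by auto
  have "- e * of_real y * \<omega> = of_real x * \<omega>" using x fz[of 0] y(1) by (simp add: mult.assoc)
  moreover have "\<omega> \<noteq> 0" using \<omega> by auto
  ultimately have eq: "- e * of_real y = of_real x"
    using mult_right_cancel[of \<omega> "- e * of_real y" "of_real x"] by blast
  have "e * of_real y = - (- e * of_real y)" by simp
  also note eq
  finally have "e * of_real y = of_real (- x)" by simp
  define q where "q = - x / y"
  have eq: "e = of_real q"
    unfolding q_def of_real_divide using \<open>e * of_real y = of_real (- x)\<close> y0
    by (intro eq_divide_imp) simp_all
  have "\<bar>q\<bar> = 1" using e1 unfolding eq norm_of_real .
  then have "q = 1 \<or> q = - 1" by linarith
  then have "e = 1 \<or> e = - 1" using eq by auto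
  moreover have "e \<noteq> - 1"
  proof
    assume e: "e = - 1"
    \<comment> \<open>The fixed point of the half-turn, on the diameter.\<close>
    obtain c where c: "\<bar>c\<bar> < 1" "y * (1 + c\<^sup>2) = 2 * c" using quadratic_root_in_disc[OF y(2)] .
    have nc: "norm (of_real c * \<omega>) < 1" using c \<omega> by (simp add: norm_mult)
    have "\<bar>y\<bar> * \<bar>c\<bar> < 1 * 1" using y(2) c(1) by (intro mult_strict_mono) auto
    then have yc: "1 - y * c \<noteq> 0" using abs_mult[of y c] by auto
    have "cnj w * (of_real c * \<omega>) = of_real (y * c) * (cnj \<omega> * \<omega>)" unfolding y(1) by simp
    then have den: "1 - cnj w * (of_real c * \<omega>) = of_real (1 - y * c)" unfolding ww by simp
    have num: "- 1 * (of_real c * \<omega> - w) = of_real (y - c) * \<omega>"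
      unfolding y(1) by (simp add: algebra_simps)
    have "f (of_real c * \<omega>) = of_real (y - c) * \<omega> / of_real (1 - y * c)"
      using fz[of "of_real c * \<omega>"] nc unfolding den e num by (simp only: less_imp_le)
    also have "\<dots> = of_real ((y - c) / (1 - y * c)) * \<omega>" unfolding of_real_divide by simp
    also have "(y - c) / (1 - y * c) = c" using yc c(2) by (simp add: field_simps power2_eq_square)
    finally show False using nofix[OF nc] by simp
  qed
  ultimately have "e = 1" by blast
  show thesis
  proof (rule that[of "- y"])
    show "\<bar>- y\<bar> < 1" using y by simp
    fix z :: complex assume "z \<in> cball 0 1"
    then show "f z = translation (of_real (- y) * \<omega>) z"
      using fz[of z] \<open>e = 1\<close> y(1) by (simp add: translation_def)
  qed
qed

lemma translation_rotate:
  assumes "norm \<omega> = 1"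
  shows "translation (\<beta> * \<omega>) (z * \<omega>) = translation \<beta> z * \<omega>"
proof -
  have "cnj \<omega> * \<omega> = 1" using assms complex_norm_square[of \<omega>] by (simp add: mult.commute)
  then have "cnj (\<beta> * \<omega>) * (z * \<omega>) = cnj \<beta> * z" by (metis complex_cnj_mult mult.assoc mult.commute mult.left_neutral)
  then show ?thesis unfolding translation_def by (simp add: distrib_right)
qed

lemma circle_power_rotate:
  assumes "norm \<omega> = 1"
  shows "circle_power (c * \<omega>) (z * \<omega>) = circle_power c z"
proof -
  have "cnj \<omega> * \<omega> = 1" using assms complex_norm_square[of \<omega>] by (simp add: mult.commute)
  then have eq: "cnj (c * \<omega>) * (z * \<omega>) = cnj c * z" by (metis complex_cnj_mult mult.assoc mult.commute mult.left_neutral)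
  show ?thesis unfolding circle_power_def eq norm_mult assms by simp
qed

lemma circle_power_translation_raw:
  fixes s u :: real
  assumes u: "\<bar>u\<bar> < 1" and z: "norm z \<le> 1"
  shows "circle_power (of_real s) (translation (of_real u) z) * (norm (1 + of_real u * z))\<^sup>2 =
    (1 + u\<^sup>2 - 2 * s * u) * (1 + (norm z)\<^sup>2) + (4 * u - 2 * s * (1 + u\<^sup>2)) * Re z"
proof -
  define d where "d = 1 + of_real u * z"
  have d: "d \<noteq> 0" using translation_denominator[of "of_real u" z] u z by (simp add: d_def)
  define a where "a = z + of_real u"
  have tr: "translation (of_real u) z = a / d" by (simp add: translation_def a_def d_def)
  have "Re (a / d) * (norm d)\<^sup>2 = Re (a * cnj d)"
  proof -
    have "a / d * of_real ((norm d)\<^sup>2) = a * cnj d"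
      unfolding complex_norm_square using d by simp
    moreover have "Re (y * of_real r) = Re y * r" for y r by simp
    ultimately show ?thesis by metis
  qed
  moreover have "(norm (a / d))\<^sup>2 * (norm d)\<^sup>2 = (norm a)\<^sup>2"
    using d by (simp add: norm_divide power_divide)
  moreover have "circle_power (of_real s) q * D = D + (norm q)\<^sup>2 * D - 2 * s * (Re q * D)" for q D
    unfolding circle_power_def by (simp add: algebra_simps)
  ultimately have "circle_power (of_real s) (a / d) * (norm d)\<^sup>2 = (norm d)\<^sup>2 + (norm a)\<^sup>2 - 2 * s * Re (a * cnj d)"
    by (simp only:)
  also have "\<dots> = (1 + u\<^sup>2 - 2 * s * u) * (1 + (norm z)\<^sup>2) + (4 * u - 2 * s * (1 + u\<^sup>2)) * Re z"
    unfolding a_def d_def cmod_power2 by (simp add: power2_eq_square algebra_simps)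
  finally show ?thesis unfolding tr d_def .
qed

text \<open>
  The translation carries the geodesic with centre \<open>s' \<omega>\<close> to the one with centre \<open>s \<omega>\<close>, which is what
  the equation between \<open>s\<close>, \<open>s'\<close> and \<open>u\<close> says.  Both powers then vanish at the same points, and they
  are proportional up to a positive factor; the sign of the constant \<open>1 + u\<^sup>2 - 2 * s * u\<close> decides which sides correspond.
\<close>
lemma circle_power_translation:
  fixes s s' u :: real
  assumes u: "\<bar>u\<bar> < 1" and z: "norm z \<le> 1" and \<omega>: "norm \<omega> = 1"
    and pair: "s' * (1 + u\<^sup>2 - 2 * s * u) = s * (1 + u\<^sup>2) - 2 * u"
  shows "\<exists>k>0. circle_power (of_real s * \<omega>) (translation (of_real u * \<omega>) z) * k =
    (1 + u\<^sup>2 - 2 * s * u) * circle_power (of_real s' * \<omega>) z"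
proof -
  have "cnj \<omega> * \<omega> = 1" using \<omega> complex_norm_square[of \<omega>] by (simp add: mult.commute)
  define y where "y = cnj \<omega> * z"
  have zy: "z = y * \<omega>" unfolding y_def using \<open>cnj \<omega> * \<omega> = 1\<close> by (metis mult.assoc mult.commute mult.left_neutral)
  have y: "norm y \<le> 1" unfolding y_def using z \<omega> by (simp add: norm_mult)
  have "circle_power (of_real s) (translation (of_real u) y) * (norm (1 + of_real u * y))\<^sup>2 =
    (1 + u\<^sup>2 - 2 * s * u) * (1 + (norm y)\<^sup>2) - 2 * (s * (1 + u\<^sup>2) - 2 * u) * Re y"
    unfolding circle_power_translation_raw[OF u y] by (simp add: algebra_simps)
  also have "\<dots> = (1 + u\<^sup>2 - 2 * s * u) * circle_power (of_real s') y"
    unfolding pair[symmetric] circle_power_def by (simp add: algebra_simps)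
  finally have "circle_power (of_real s * \<omega>) (translation (of_real u * \<omega>) z) * (norm (1 + of_real u * y))\<^sup>2 =
    (1 + u\<^sup>2 - 2 * s * u) * circle_power (of_real s' * \<omega>) z"
    unfolding zy translation_rotate[OF \<omega>] circle_power_rotate[OF \<omega>] .
  moreover have "0 < (norm (1 + of_real u * y))\<^sup>2"
    using translation_denominator[of "of_real u" y] u y by simp
  ultimately show ?thesis by blast
qed

text \<open>
  The two geodesics lie on opposite sides of the origin, so the translation carries the outside of
  the first to the inside of the second.
\<close>
lemma pairing_factor_negative:
  fixes s s' u :: real
  assumes "1 < \<bar>s\<bar>" "s * s' < 0" and "s' * (1 + u\<^sup>2 - 2 * s * u) = s * (1 + u\<^sup>2) - 2 * u"
  shows "1 + u\<^sup>2 - 2 * s * u < 0"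
proof (rule ccontr)
  define k where "k = 1 + u\<^sup>2 - 2 * s * u"
  assume "\<not> ?thesis"
  then have k: "0 \<le> k" by (simp add: k_def)
  have "2 * \<bar>u\<bar> \<le> 1 + u\<^sup>2"
    using zero_le_power2[of "\<bar>u\<bar> - 1"] by (simp add: power2_diff)
  moreover have "1 * (1 + u\<^sup>2) < \<bar>s\<bar> * (1 + u\<^sup>2)"
    using assms(1) by (intro mult_strict_right_mono) (auto simp: add_pos_nonneg)
  ultimately have lt: "2 * \<bar>u\<bar> < \<bar>s\<bar> * (1 + u\<^sup>2)" by simp
  have eq: "s' * k = s * (1 + u\<^sup>2) - 2 * u" using assms(3) k_def by simp
  show False
  proof (cases "0 < s")
    case True
    then have "s' < 0" using assms(2) by (simp add: mult_less_0_iff)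
    then have "s' * k \<le> 0" using k by (simp add: mult_nonpos_nonneg)
    then show False using lt eq True by simp
  next
    case False
    then have "0 < s'" "s < 0" using assms(1,2) by (auto simp: mult_less_0_iff)
    then have "0 \<le> s' * k" using k by simp
    then show False using lt eq \<open>s < 0\<close> by simp
  qed
qed

text \<open>
  It suffices to follow the point where the geodesic meets its diameter.
\<close>
lemma pairing_equation:
  fixes s s' u :: real
  assumes u: "\<bar>u\<bar> < 1" and s: "1 < \<bar>s\<bar>" "1 < \<bar>s'\<bar>" and \<omega>: "norm \<omega> = 1"
    and im: "\<And>z. z \<in> geodesic_arc (of_real s' * \<omega>) \<Longrightarrow> translation (of_real u * \<omega>) z \<in> geodesic_arc (of_real s * \<omega>)"
  shows "s' * (1 + u\<^sup>2 - 2 * s * u) = s * (1 + u\<^sup>2) - 2 * u"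
proof -
  have n: "1 < norm (of_real s * \<omega>)" "1 < norm (of_real s' * \<omega>)" using s \<omega> by (simp_all add: norm_mult)
  have "\<bar>1 / s'\<bar> < 1" using s by (simp add: abs_divide divide_less_eq)
  then obtain x where x: "\<bar>x\<bar> < 1" "1 / s' * (1 + x\<^sup>2) = 2 * x" by (rule quadratic_root_in_disc)
  then have x2: "1 + x\<^sup>2 = 2 * s' * x" using s by (simp add: field_simps)
  have "x \<noteq> 0" using x2 by auto
  have "circle_power (of_real s' * \<omega>) (of_real x * \<omega>) = 0"
    unfolding circle_power_rotate[OF \<omega>] using x2 by (simp add: circle_power_def)
  then have "of_real x * \<omega> \<in> geodesic_arc (of_real s' * \<omega>)"
    unfolding geodesic_arc_eq[OF n(2)] using x(1) \<omega> by (simp add: norm_mult)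
  from im[OF this] have "circle_power (of_real s * \<omega>) (translation (of_real u * \<omega>) (of_real x * \<omega>)) = 0"
    unfolding geodesic_arc_eq[OF n(1)] by simp
  then have "circle_power (of_real s) (translation (of_real u) (of_real x)) = 0"
    unfolding translation_rotate[OF \<omega>] circle_power_rotate[OF \<omega>] .
  then have "(1 + u\<^sup>2 - 2 * s * u) * (1 + x\<^sup>2) + (4 * u - 2 * s * (1 + u\<^sup>2)) * x = 0"
    using circle_power_translation_raw[OF u, of "of_real x" s] x(1) by simp
  then have "2 * x * (s' * (1 + u\<^sup>2 - 2 * s * u) - (s * (1 + u\<^sup>2) - 2 * u)) = 0"
    unfolding x2 by (simp add: algebra_simps)
  then show ?thesis using \<open>x \<noteq> 0\<close> by simp
qed

section \<open>The Schottky group\<close>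

text \<open>
  Each half-disc bounds one coordinate from below; a common point would satisfy
  \<open>(1 + (norm z)\<^sup>2) / 2 < norm z\<close>, which is impossible.
\<close>
lemma perpendicular_disjoint:
  fixes s t :: real
  assumes "1 < (1/s)\<^sup>2 + (1/t)\<^sup>2" "s \<noteq> 0" "t \<noteq> 0"
    and "circle_power (of_real s) z \<le> 0" "circle_power (of_real t * \<i>) z \<le> 0"
  shows False
proof -
  define k where "k = (1 + (norm z)\<^sup>2) / 2"
  have k: "0 < k" unfolding k_def by (simp add: add_pos_nonneg)
  have s: "k \<le> s * Re z" and t: "k \<le> t * Im z"
    using assms(4,5) by (auto simp: circle_power_def k_def)
  have "k\<^sup>2 \<le> (s * Re z)\<^sup>2" "k\<^sup>2 \<le> (t * Im z)\<^sup>2" using s t k by (intro power_mono; simp)+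
  then have "(1/s)\<^sup>2 * k\<^sup>2 \<le> (Re z)\<^sup>2" "(1/t)\<^sup>2 * k\<^sup>2 \<le> (Im z)\<^sup>2"
    using assms(2,3) by (simp_all add: power_mult_distrib power_divide field_simps)
  then have "((1/s)\<^sup>2 + (1/t)\<^sup>2) * k\<^sup>2 \<le> (norm z)\<^sup>2"
    unfolding cmod_power2 distrib_right by linarith
  moreover have "1 * k\<^sup>2 < ((1/s)\<^sup>2 + (1/t)\<^sup>2) * k\<^sup>2"
    using assms(1) k by (intro mult_strict_right_mono) auto
  ultimately have "k\<^sup>2 < (norm z)\<^sup>2" by simp
  then have "k < norm z" by (rule power_less_imp_less_base) simp
  moreover have "norm z \<le> k"
    unfolding k_def using zero_le_power2[of "norm z - 1"] by (simp add: power2_diff)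
  ultimately show False by simp
qed

lemma opposite_disjoint:
  fixes s s' :: real
  assumes "s * s' < 0" "norm \<omega> = 1"
    and "circle_power (of_real s * \<omega>) z \<le> 0" "circle_power (of_real s' * \<omega>) z \<le> 0"
  shows False
proof -
  define r where "r = Re (cnj \<omega> * z)"
  have "circle_power (of_real s * \<omega>) z = 1 + (norm z)\<^sup>2 - 2 * (s * r)" for s
    unfolding circle_power_def r_def by (simp add: algebra_simps)
  moreover have "0 < 1 + (norm z)\<^sup>2" by (simp add: add_pos_nonneg)
  ultimately have "0 < s * r" "0 < s' * r" using assms(3,4) by auto
  then have "0 < (s * r) * (s' * r)" by simp
  also have "\<dots> = (s * s') * r\<^sup>2" by (simp add: power2_eq_square)
  also have "\<dots> \<le> 0" using assms(1) by (simp add: mult_nonpos_nonneg)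
  finally show False by simp
qed

text \<open>
  The letters stand for $g$, $g^{-1}$, $h$, $h^{-1}$, and also for the half-discs into which these map.
\<close>
datatype letter = Lg | Lg' | Lh | Lh'

fun opp :: "letter \<Rightarrow> letter" where
  "opp Lg = Lg'" | "opp Lg' = Lg" | "opp Lh = Lh'" | "opp Lh' = Lh"

lemma opp_opp: "opp (opp c) = c"
  by (cases c) auto

text \<open>
  The sums of squares express that a geodesic orthogonal to the real axis and one orthogonal to the
  imaginary axis have disjoint closures; \<open>u\<close> and \<open>v\<close> are the images of \<open>0\<close> under the generators.
\<close>
locale schottky =
  fixes s s' t t' u v :: real
  assumes centers: "1 < \<bar>s\<bar>" "1 < \<bar>s'\<bar>" "1 < \<bar>t\<bar>" "1 < \<bar>t'\<bar>"
    and opposite: "s * s' < 0" "t * t' < 0"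
    and separated: "1 < (1/s)\<^sup>2 + (1/t)\<^sup>2" "1 < (1/s)\<^sup>2 + (1/t')\<^sup>2"
      "1 < (1/s')\<^sup>2 + (1/t)\<^sup>2" "1 < (1/s')\<^sup>2 + (1/t')\<^sup>2"
    and lengths: "\<bar>u\<bar> < 1" "\<bar>v\<bar> < 1"
    and pairings: "s' * (1 + u\<^sup>2 - 2 * s * u) = s * (1 + u\<^sup>2) - 2 * u"
      "t' * (1 + v\<^sup>2 - 2 * t * v) = t * (1 + v\<^sup>2) - 2 * v"
begin

primrec center :: "letter \<Rightarrow> complex" where
  "center Lg = of_real s" | "center Lg' = of_real s'"
| "center Lh = of_real t * \<i>" | "center Lh' = of_real t' * \<i>"

primrec shift :: "letter \<Rightarrow> complex" where
  "shift Lg = of_real u" | "shift Lg' = - of_real u"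
| "shift Lh = of_real v * \<i>" | "shift Lh' = - (of_real v * \<i>)"

definition \<phi> :: "letter \<Rightarrow> complex \<Rightarrow> complex" where
  "\<phi> c = translation (shift c)"

definition half_disc :: "letter \<Rightarrow> complex set" where
  "half_disc c = {z \<in> cball 0 1. circle_power (center c) z < 0}"

lemma shift_less: "norm (shift c) < 1"
  using lengths by (cases c) (auto simp: norm_mult)

lemma shift_opp: "shift (opp c) = - shift c"
  by (cases c) auto

lemma phi_moebius: "unit_disc_moebius (\<phi> c)"
  unfolding \<phi>_def using translation_moebius[OF shift_less] .

lemma phi_opp: "z \<in> cball 0 1 \<Longrightarrow> \<phi> (opp c) (\<phi> c z) = z"
  unfolding \<phi>_def shift_opp using translation_inverse[OF shift_less, of z c] by simp

lemma phi_cball: "z \<in> cball 0 1 \<Longrightarrow> \<phi> c z \<in> cball 0 1"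
  using unit_disc_moebius_norm(1)[OF phi_moebius] by simp

lemma circle_power_phi:
  assumes "c = Lg \<or> c = Lh" "z \<in> cball 0 1"
  shows "circle_power (center c) (\<phi> c z) < 0 \<longleftrightarrow> 0 < circle_power (center (opp c)) z"
    "0 < circle_power (center c) (\<phi> c z) \<longleftrightarrow> circle_power (center (opp c)) z < 0"
proof -
  have "\<exists>k>0. \<exists>l<0. circle_power (center c) (\<phi> c z) * k = l * circle_power (center (opp c)) z"
    using assms(1)
  proof
    assume c: "c = Lg"
    have "\<exists>k>0. circle_power (center c) (\<phi> c z) * k = (1 + u\<^sup>2 - 2 * s * u) * circle_power (center (opp c)) z"
      using circle_power_translation[OF lengths(1) _ _ pairings(1), of z 1] assms(2) by (simp add: \<phi>_def c)
    then show ?thesis using pairing_factor_negative[OF centers(1) opposite(1) pairings(1)] by blast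
  next
    assume c: "c = Lh"
    have "\<exists>k>0. circle_power (center c) (\<phi> c z) * k = (1 + v\<^sup>2 - 2 * t * v) * circle_power (center (opp c)) z"
      using circle_power_translation[OF lengths(2) _ _ pairings(2), of z \<i>] assms(2) by (simp add: \<phi>_def c)
    then show ?thesis using pairing_factor_negative[OF centers(3) opposite(2) pairings(2)] by blast
  qed
  then obtain k l where kl: "0 < k" "l < 0"
    "circle_power (center c) (\<phi> c z) * k = l * circle_power (center (opp c)) z" by blast
  have "circle_power (center c) (\<phi> c z) < 0 \<longleftrightarrow> circle_power (center c) (\<phi> c z) * k < 0"
    using kl(1) by (simp add: mult_less_0_iff)
  also have "\<dots> \<longleftrightarrow> 0 < circle_power (center (opp c)) z"
    unfolding kl(3) using kl(2) by (simp add: mult_less_0_iff)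
  finally show "circle_power (center c) (\<phi> c z) < 0 \<longleftrightarrow> 0 < circle_power (center (opp c)) z" .
  have "0 < circle_power (center c) (\<phi> c z) \<longleftrightarrow> 0 < circle_power (center c) (\<phi> c z) * k"
    using kl(1) by (simp add: zero_less_mult_iff)
  also have "\<dots> \<longleftrightarrow> circle_power (center (opp c)) z < 0"
    unfolding kl(3) using kl(2) by (simp add: zero_less_mult_iff)
  finally show "0 < circle_power (center c) (\<phi> c z) \<longleftrightarrow> circle_power (center (opp c)) z < 0" .
qed

lemma phi_half_disc:
  assumes z: "z \<in> cball 0 1"
  shows "circle_power (center c) (\<phi> c z) < 0 \<longleftrightarrow> 0 < circle_power (center (opp c)) z"
proof (cases "c = Lg \<or> c = Lh")
  case True
  then show ?thesis using circle_power_phi z by blast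
next
  case False
  then have c: "opp c = Lg \<or> opp c = Lh" by (cases c) auto
  have "\<phi> (opp c) (\<phi> c z) = z" using phi_opp[OF z] .
  then show ?thesis using circle_power_phi(2)[OF c phi_cball[OF z, of c]] by (simp add: opp_opp)
qed

lemma closed_half_discs_disjoint:
  assumes "c \<noteq> d" and c: "circle_power (center c) z \<le> 0"
  shows "0 < circle_power (center d) z"
proof (rule ccontr)
  assume "\<not> ?thesis"
  then have d: "circle_power (center d) z \<le> 0" by simp
  have nz: "s \<noteq> 0" "s' \<noteq> 0" "t \<noteq> 0" "t' \<noteq> 0" using centers by auto
  note perp = perpendicular_disjoint[OF separated(1) nz(1,3), of z]
    perpendicular_disjoint[OF separated(2) nz(1,4), of z]
    perpendicular_disjoint[OF separated(3) nz(2,3), of z]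
    perpendicular_disjoint[OF separated(4) nz(2,4), of z]
  note opp = opposite_disjoint[OF opposite(1), of 1 z] opposite_disjoint[OF opposite(2), of \<i> z]
  show False using c d \<open>c \<noteq> d\<close> perp opp by (cases c; cases d) auto
qed

sublocale ping_pong "cball 0 1" opp \<phi> half_disc
proof
  fix c d z
  show "opp (opp c) = c" by (rule opp_opp)
  show "z \<in> cball 0 1 \<Longrightarrow> \<phi> c z \<in> cball 0 1" by (rule phi_cball)
  show "z \<in> cball 0 1 \<Longrightarrow> \<phi> (opp c) (\<phi> c z) = z" by (rule phi_opp)
  show "half_disc c \<subseteq> cball 0 1" by (auto simp: half_disc_def)
  show "half_disc c \<inter> half_disc d = {}" if "c \<noteq> d"
  proof -
    have "\<not> circle_power (center d) z < 0" if "circle_power (center c) z < 0" for z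
      using closed_half_discs_disjoint[OF \<open>c \<noteq> d\<close>, of z] that by simp
    then show ?thesis unfolding half_disc_def by blast
  qed
  assume "d \<noteq> opp c" "z \<in> half_disc d"
  then have z: "z \<in> cball 0 1" "0 < circle_power (center (opp c)) z"
    using closed_half_discs_disjoint[of d "opp c" z] by (auto simp: half_disc_def)
  then show "\<phi> c z \<in> half_disc c"
    using phi_half_disc[OF z(1)] phi_cball[OF z(1)] unfolding half_disc_def by simp
qed

lemma exterior_iff: "z \<in> exterior \<longleftrightarrow> z \<in> cball 0 1 \<and> (\<forall>c. 0 < circle_power (center c) z)"
proof -
  have "\<phi> c z \<in> half_disc c \<longleftrightarrow> 0 < circle_power (center (opp c)) z" if "z \<in> cball 0 1" for c
    using phi_half_disc[OF that] phi_cball[OF that] unfolding half_disc_def by simp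
  moreover have "(\<forall>c. 0 < circle_power (center (opp c)) z) \<longleftrightarrow> (\<forall>c. 0 < circle_power (center c) z)"
    by (metis opp_opp)
  ultimately show ?thesis unfolding exterior_def by blast
qed

lemma zero_exterior: "0 \<in> exterior"
  unfolding exterior_iff by (simp add: circle_power_def)

lemma circle_power_sphere:
  assumes "norm z = 1"
  shows "circle_power (of_real a) z = 2 - 2 * (a * Re z)" "circle_power (of_real a * \<i>) z = 2 - 2 * (a * Im z)"
  using assms by (simp_all add: circle_power_def)

lemma exterior_on_circle:
  obtains r where "r \<in> exterior" "norm r = 1"
proof -
  have signs: "\<exists>A A'. {a, a'} = {A, A'} \<and> 1 < A \<and> A' < 0"
    if "1 < \<bar>a\<bar>" "1 < \<bar>a'\<bar>" "a * a' < 0" for a a' :: real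
  proof (cases "0 < a")
    case True
    then show ?thesis using that by (intro exI[of _ a] exI[of _ a']) (auto simp: mult_less_0_iff)
  next
    case False
    then show ?thesis using that by (intro exI[of _ a'] exI[of _ a]) (auto simp: mult_less_0_iff)
  qed
  obtain S S' where S: "{s, s'} = {S, S'}" "1 < S" "S' < 0"
    using signs[OF centers(1,2) opposite(1)] by blast
  obtain T T' where T: "{t, t'} = {T, T'}" "1 < T" "T' < 0"
    using signs[OF centers(3,4) opposite(2)] by blast
  have sep: "1 < (1/S)\<^sup>2 + (1/T)\<^sup>2" using separated S(1) T(1) by (auto simp: doubleton_eq_iff)
  define a b where "a = (1/S)\<^sup>2" and "b = (1/T)\<^sup>2"
  have ab: "0 \<le> a" "a < 1" "0 \<le> b" "b < 1" "1 < a + b"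
    using S T sep by (simp_all add: a_def b_def power_divide)
  \<comment> \<open>The squares of the coordinates of a point strictly between two neighbouring arcs.\<close>
  define X Y where "X = (1 + a - b) / 2" and "Y = (1 - a + b) / 2"
  have XY: "0 < X" "0 < Y" "X + Y = 1" "X < a" "Y < b"
    using ab unfolding X_def Y_def by (simp_all add: field_simps)
  define r where "r = Complex (sqrt X) (sqrt Y)"
  have r1: "norm r = 1" unfolding r_def cmod_def using XY by simp
  have "sqrt X < 1/S" using real_sqrt_less_mono[OF XY(4)] S by (simp add: a_def)
  then have rS: "S * Re r < 1" "S' * Re r < 1"
    using S XY mult_neg_pos[of S' "sqrt X"] by (simp_all add: r_def field_simps)
  have "sqrt Y < 1/T" using real_sqrt_less_mono[OF XY(5)] T by (simp add: b_def)
  then have rT: "T * Im r < 1" "T' * Im r < 1"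
    using T XY mult_neg_pos[of T' "sqrt Y"] by (simp_all add: r_def field_simps)
  show thesis
  proof (rule that[OF _ r1])
    have "0 < circle_power (center c) r" for c
      using rS rT S(1) T(1) circle_power_sphere[OF r1] by (cases c) (auto simp: doubleton_eq_iff)
    then show "r \<in> exterior" unfolding exterior_iff using r1 by simp
  qed
qed

lemma words_moebius: "f \<in> words \<Longrightarrow> unit_disc_moebius f"
  by (induction rule: words.induct) (simp_all only: unit_disc_moebius_id unit_disc_moebius_comp phi_moebius)

section \<open>Barriers across a positive word\<close>

definition path :: "nat set \<Rightarrow> nat \<Rightarrow> letter" where
  "path P j = (if j \<in> P then Lh else Lg)"

lemma reduced_path: "reduced (path P)"
  unfolding reduced_def path_def by auto

lemma words_sphere: "f \<in> words \<Longrightarrow> z \<in> sphere 0 1 \<Longrightarrow> f z \<in> sphere 0 1"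
  using unit_disc_moebius_norm(2)[OF words_moebius] by simp

text \<open>
  Let $A_c$ be the arc of the half-disc of $c$.  The barrier contains $A_{g^{-1}}$ and the arcs $g^i(A_h)$
  for $0 \<le> i \<le> N$, and it avoids the arcs $g^i(A_{h^{-1}})$ for these $i$ and the last arc
  $g^N(A_g)$: it is the part of the circle behind and, on the side of $h$, beside the segment
  $1, g, \<dots>, g^N$ of the axis of $g$.
\<close>
definition barrier :: "nat \<Rightarrow> complex set" where
  "barrier N = {z \<in> sphere 0 1. circle_power (center Lg') z < 0} \<union>
    {z \<in> sphere 0 1. 0 < t * Im z \<and> z \<notin> (\<phi> Lg ^^ N) ` {z \<in> sphere 0 1. circle_power (center Lg) z \<le> 0}}"

lemma phi_Lg_Im_sign:
  assumes "z \<in> cball 0 1"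
  shows "0 < t * Im (\<phi> Lg z) \<longleftrightarrow> 0 < t * Im z"
proof -
  define d where "d = 1 + of_real u * z"
  have d: "d \<noteq> 0" using translation_denominator[of "of_real u" z] lengths assms by (simp add: d_def)
  have "\<phi> Lg z * of_real ((norm d)\<^sup>2) = (z + of_real u) * cnj d"
    unfolding complex_norm_square \<phi>_def translation_def using d by (simp add: d_def)
  then have "Im (\<phi> Lg z * of_real ((norm d)\<^sup>2)) = (1 - u\<^sup>2) * Im z"
    unfolding d_def by (simp add: algebra_simps power2_eq_square)
  moreover have "Im (y * of_real r) = Im y * r" for y r by simp
  ultimately have eq: "Im (\<phi> Lg z) * (norm d)\<^sup>2 = (1 - u\<^sup>2) * Im z" by metis
  have "0 < t * Im (\<phi> Lg z) \<longleftrightarrow> 0 < t * Im (\<phi> Lg z) * (norm d)\<^sup>2"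
    using d by (simp add: zero_less_mult_iff)
  also have "\<dots> \<longleftrightarrow> 0 < (1 - u\<^sup>2) * (t * Im z)"
    unfolding mult.assoc eq by (simp only: mult.left_commute)
  also have "\<dots> \<longleftrightarrow> 0 < t * Im z"
  proof -
    have "0 < 1 - u\<^sup>2" using lengths(1) by (simp add: abs_square_less_1)
    then show ?thesis by (simp add: zero_less_mult_iff)
  qed
  finally show ?thesis .
qed

lemma phi_inj:
  assumes "z \<in> cball 0 1" "y \<in> cball 0 1" "\<phi> c z = \<phi> c y"
  shows "z = y"
proof -
  have "z = \<phi> (opp c) (\<phi> c z)" using opp_inverse[OF assms(1)] by (rule sym)
  also have "\<dots> = \<phi> (opp c) (\<phi> c y)" by (simp only: assms(3))
  also have "\<dots> = y" using opp_inverse[OF assms(2)] .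
  finally show ?thesis .
qed

lemma phi_sphere: "z \<in> sphere 0 1 \<Longrightarrow> \<phi> c z \<in> sphere 0 1"
  using unit_disc_moebius_norm(2)[OF phi_moebius] by simp

lemma funpow_cap:
  assumes "z \<in> (\<phi> Lg ^^ N) ` {z \<in> sphere 0 1. circle_power (center Lg) z \<le> 0}"
  shows "z \<in> sphere 0 1 \<and> circle_power (center Lg) z \<le> 0"
  using assms
proof (induction N arbitrary: z)
  case (Suc N)
  from Suc.prems obtain y where y: "z = \<phi> Lg y"
    "y \<in> (\<phi> Lg ^^ N) ` {z \<in> sphere 0 1. circle_power (center Lg) z \<le> 0}"
    unfolding funpow.simps image_comp[symmetric] by (rule imageE)
  from Suc.IH[OF y(2)] have y': "y \<in> sphere 0 1" "circle_power (center Lg) y \<le> 0" by blast+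
  then have "circle_power (center Lg) z < 0"
    using phi_half_disc[of y Lg] closed_half_discs_disjoint[of Lg Lg' y] y(1) by simp
  then show ?case using phi_sphere[OF y'(1)] y(1) by simp
qed simp

text \<open>
  Translating by $g$ prolongs the segment by one vertex.  This self-similarity reduces every question
  about barriers to the four basic arcs.
\<close>
lemma barrier_step:
  assumes z: "z \<in> sphere 0 1" "\<phi> Lg z \<in> half_disc Lg"
  shows "\<phi> Lg z \<in> barrier (Suc N) \<longleftrightarrow> z \<in> barrier N"
proof -
  let ?C = "{z \<in> sphere 0 1. circle_power (center Lg) z \<le> 0}"
  have zc: "z \<in> cball 0 1" using z by simp
  have "circle_power (center Lg) (\<phi> Lg z) < 0" using z unfolding half_disc_def by simp
  then have "0 < circle_power (center Lg') (\<phi> Lg z)" "0 < circle_power (center Lg') z"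
    using closed_half_discs_disjoint[of Lg Lg' "\<phi> Lg z"] phi_half_disc[OF zc, of Lg] by simp_all
  moreover have "\<phi> Lg z \<in> (\<phi> Lg ^^ Suc N) ` ?C \<longleftrightarrow> z \<in> (\<phi> Lg ^^ N) ` ?C"
  proof
    assume "\<phi> Lg z \<in> (\<phi> Lg ^^ Suc N) ` ?C"
    then obtain y where y: "y \<in> (\<phi> Lg ^^ N) ` ?C" "\<phi> Lg z = \<phi> Lg y" by auto
    then have "y \<in> cball 0 1" using funpow_cap[OF y(1)] by simp
    then have "z = y" using phi_inj zc y(2) by blast
    then show "z \<in> (\<phi> Lg ^^ N) ` ?C" using y by simp
  qed auto
  ultimately show ?thesis
    unfolding barrier_def using z phi_sphere[OF z(1)] phi_Lg_Im_sign[OF zc] by auto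
qed

lemma barrier_half_discs:
  assumes "z \<in> sphere 0 1"
  shows "z \<in> half_disc Lg' \<Longrightarrow> z \<in> barrier N" "z \<in> half_disc Lh \<Longrightarrow> z \<in> barrier N"
    "z \<in> half_disc Lh' \<Longrightarrow> z \<notin> barrier N" "z \<in> half_disc Lg \<Longrightarrow> z \<notin> barrier 0"
proof -
  have n: "norm z = 1" using assms by simp
  show "z \<in> half_disc Lg' \<Longrightarrow> z \<in> barrier N"
    using assms unfolding half_disc_def barrier_def by simp
  show "z \<in> barrier N" if "z \<in> half_disc Lh"
  proof -
    have h: "circle_power (center Lh) z < 0" using that unfolding half_disc_def by simp
    then have "0 < circle_power (center Lg) z" using closed_half_discs_disjoint[of Lh Lg z] by simp
    then have "z \<notin> (\<phi> Lg ^^ N) ` {z \<in> sphere 0 1. circle_power (center Lg) z \<le> 0}"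
      using funpow_cap[of z N] by auto
    moreover have "0 < t * Im z" using h circle_power_sphere(2)[OF n, of t] by simp
    ultimately show ?thesis using assms unfolding barrier_def by simp
  qed
  show "z \<notin> barrier N" if "z \<in> half_disc Lh'"
  proof -
    have h: "circle_power (center Lh') z < 0" using that unfolding half_disc_def by simp
    then have "0 < circle_power (center Lg') z" using closed_half_discs_disjoint[of Lh' Lg' z] by simp
    moreover have "0 < circle_power (center Lh) z" using h closed_half_discs_disjoint[of Lh' Lh z] by simp
    moreover have "\<not> 0 < t * Im z"
    proof
      assume a: "0 < t * Im z"
      have "0 < t' * Im z" using h circle_power_sphere(2)[OF n, of t'] by simp
      with a have "0 < (t * Im z) * (t' * Im z)" by simp
      also have "\<dots> = (t * t') * (Im z)\<^sup>2" by (simp add: power2_eq_square)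
      also have "\<dots> \<le> 0" using opposite(2) by (simp add: mult_nonpos_nonneg)
      finally show False by simp
    qed
    ultimately show ?thesis unfolding barrier_def by auto
  qed
  show "z \<notin> barrier 0" if "z \<in> half_disc Lg"
  proof -
    have h: "circle_power (center Lg) z < 0" using that unfolding half_disc_def by simp
    then have "0 < circle_power (center Lg') z" using closed_half_discs_disjoint[of Lg Lg' z] by simp
    then show ?thesis using h assms unfolding barrier_def by simp
  qed
qed

text \<open>
  Suppose that \<open>\<delta>\<close> moves \<open>p\<close> into the barrier and \<open>r\<close> out of it.  Both images are in the half-disc
  of the last letter of \<open>\<delta>\<close>, and a barrier contains or avoids the arc of each letter but $g$.
  Hence the last letter is $g$; it is removed by \<open>barrier_step\<close>, and the argument repeats with a
  shorter barrier until only the inverse of a prefix is left.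
\<close>
lemma branch_crossing_barrier:
  assumes "branch (path P) c \<delta>" and p: "follows (path P) p" "p \<in> sphere 0 1"
    and r: "r \<in> exterior" "r \<in> sphere 0 1"
    and "\<delta> p \<in> barrier N" "\<delta> r \<notin> barrier N"
  shows "\<exists>l j. l \<le> N \<and> \<delta> = (\<phi> Lg ^^ l) \<circ> bwd (path P) j \<and>
    bwd (path P) j p \<in> barrier (N - l) \<and> bwd (path P) j r \<notin> barrier (N - l)"
proof -
  have cross: "c = Lg \<and> N \<noteq> 0 \<and> \<delta> p \<in> barrier (N - 1) \<and> \<delta> r \<notin> barrier (N - 1)"
    if b: "branch (path P) c (\<phi> c \<circ> \<delta>)" and \<delta>: "\<delta> \<in> words"
      and bar: "(\<phi> c \<circ> \<delta>) p \<in> barrier N" "(\<phi> c \<circ> \<delta>) r \<notin> barrier N" for c \<delta> N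
  proof -
    have sph: "\<delta> p \<in> sphere 0 1" "\<delta> r \<in> sphere 0 1" using words_sphere \<delta> p r by blast+
    have sph': "\<phi> c (\<delta> p) \<in> sphere 0 1" "\<phi> c (\<delta> r) \<in> sphere 0 1" using phi_sphere sph by blast+
    have cyl: "\<phi> c (\<delta> p) \<in> half_disc c" "\<phi> c (\<delta> r) \<in> half_disc c"
      using branch_cylinder[OF b reduced_path p(1) r(1)] by simp_all
    have bar': "\<phi> c (\<delta> p) \<in> barrier N" "\<phi> c (\<delta> r) \<notin> barrier N" using bar[unfolded comp_apply] .
    have "c \<noteq> Lg'" using barrier_half_discs(1)[OF sph'(2)] cyl(2) bar'(2) by blast
    moreover have "c \<noteq> Lh" using barrier_half_discs(2)[OF sph'(2)] cyl(2) bar'(2) by blast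
    moreover have "c \<noteq> Lh'" using barrier_half_discs(3)[OF sph'(1)] cyl(1) bar'(1) by blast
    ultimately have c: "c = Lg" by (cases c) simp_all
    have "N \<noteq> 0" using barrier_half_discs(4)[OF sph'(1)] cyl(1) bar'(1) unfolding c by metis
    then obtain M where "N = Suc M" by (cases N) auto
    then show ?thesis
      using bar' cyl barrier_step[OF sph(1), of M] barrier_step[OF sph(2), of M] unfolding c by simp
  qed
  show ?thesis using assms(1,6,7)
  proof (induction arbitrary: N rule: branch.induct)
    case (leave c j)
    have b: "branch (path P) c (\<phi> c \<circ> bwd (path P) j)" using leave(1,2) by (rule branch.leave)
    from cross[OF b bwd_words leave(3,4)]
    have c: "c = Lg" "N \<noteq> 0" "bwd (path P) j p \<in> barrier (N - 1)" "bwd (path P) j r \<notin> barrier (N - 1)"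
      by blast+
    show ?case
    proof (intro exI conjI)
      show "1 \<le> N" using c by simp
      show "\<phi> c \<circ> bwd (path P) j = (\<phi> Lg ^^ 1) \<circ> bwd (path P) j" unfolding c by simp
    qed (use c in blast)+
  next
    case (extend d \<delta> c)
    have b: "branch (path P) c (\<phi> c \<circ> \<delta>)" using extend(1,2) by (rule branch.extend)
    from cross[OF b branch_words[OF extend(1)] extend(4,5)]
    have c: "c = Lg" "N \<noteq> 0" "\<delta> p \<in> barrier (N - 1)" "\<delta> r \<notin> barrier (N - 1)" by simp_all
    from extend.IH[OF c(3,4)] obtain l j where l: "l \<le> N - 1" "\<delta> = (\<phi> Lg ^^ l) \<circ> bwd (path P) j"
      "bwd (path P) j p \<in> barrier (N - 1 - l)" "bwd (path P) j r \<notin> barrier (N - 1 - l)" by blast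
    show ?case
    proof (intro exI conjI)
      show "Suc l \<le> N" using l c by simp
      show "\<phi> c \<circ> \<delta> = (\<phi> Lg ^^ Suc l) \<circ> bwd (path P) j" unfolding c l by (simp add: comp_assoc)
    qed (use l in simp_all)
  qed
qed

lemma follows_sphere_step:
  assumes "follows (path P) p" "p \<in> sphere 0 1"
  shows "bwd (path P) j p \<in> sphere 0 1" "bwd (path P) j p \<in> half_disc (path P j)"
    "bwd (path P) j p = \<phi> (path P j) (bwd (path P) (Suc j) p)"
  using assms words_sphere[OF bwd_words] bwd_step[of p] unfolding follows_def by auto

lemma barrier_shift:
  assumes p: "follows (path P) p" "p \<in> sphere 0 1" and "j \<notin> P"
  shows "bwd (path P) j p \<in> barrier (Suc N) \<longleftrightarrow> bwd (path P) (Suc j) p \<in> barrier N"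
proof -
  have Lg: "path P j = Lg" using assms(3) by (simp add: path_def)
  have eq: "\<phi> Lg (bwd (path P) (Suc j) p) = bwd (path P) j p"
    using follows_sphere_step(3)[OF p, of j] unfolding Lg by (rule sym)
  show ?thesis
    using barrier_step[OF follows_sphere_step(1)[OF p, of "Suc j"], of N]
      follows_sphere_step(2)[OF p, of j] unfolding eq Lg by blast
qed

text \<open>
  A point whose itinerary starts with more than \<open>N\<close> letters $g$ is in the arc of $g$ seen from the vertex
  $g^N$, beyond the end of the barrier.
\<close>
lemma barrier_imp_turn:
  assumes p: "follows (path P) p" "p \<in> sphere 0 1" and "bwd (path P) j p \<in> barrier N"
  shows "\<exists>n\<le>N. j + n \<in> P"
  using assms(3)
proof (induction N arbitrary: j)
  case 0
  have "path P j \<noteq> Lg"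
    using barrier_half_discs(4)[OF follows_sphere_step(1)[OF p]] follows_sphere_step(2)[OF p] 0 by metis
  then show ?case by (auto simp: path_def split: if_splits)
next
  case (Suc N)
  show ?case
  proof (cases "j \<in> P")
    case False
    then have "bwd (path P) (Suc j) p \<in> barrier N" using Suc.prems barrier_shift[OF p] by blast
    then obtain n where "n \<le> N" "Suc j + n \<in> P" using Suc.IH by blast
    then show ?thesis by (intro exI[of _ "Suc n"]) auto
  qed (auto intro: exI[of _ 0])
qed

lemma turn_imp_barrier:
  assumes p: "follows (path P) p" "p \<in> sphere 0 1" and "j + n \<in> P" "\<And>i. i < n \<Longrightarrow> j + i \<notin> P"
  shows "bwd (path P) j p \<in> barrier n"
  using assms(3,4)
proof (induction n arbitrary: j)
  case 0
  then have "path P j = Lh" by (simp add: path_def)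
  then show ?case using barrier_half_discs(2) follows_sphere_step(1,2)[OF p, of j] by metis
next
  case (Suc n)
  have "j \<notin> P" using Suc.prems(2)[of 0] by simp
  moreover have "bwd (path P) (Suc j) p \<in> barrier n"
  proof (rule Suc.IH)
    show "Suc j + n \<in> P" using Suc.prems(1) by simp
    show "Suc j + i \<notin> P" if "i < n" for i using Suc.prems(2)[of "Suc i"] that by simp
  qed
  ultimately show ?case using barrier_shift[OF p] by blast
qed

lemma funpow_words: "(\<phi> c ^^ l) \<in> words"
  by (induction l) (simp_all only: funpow.simps words.intros)

text \<open>
  For infinite sets: the gaps between consecutive elements tend to infinity.
\<close>
definition sparse :: "nat set \<Rightarrow> bool" where
  "sparse P \<longleftrightarrow> (\<forall>N. finite {a \<in> P. \<exists>b\<in>P. a < b \<and> b \<le> a + N})"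

text \<open>
  For a crossing at a position \<open>j > 0\<close> of the word, the letter before \<open>j\<close> is $h$ (otherwise \<open>r\<close> would be seen
  in the half-disc of $g^{-1}$, inside the barrier), and the next $h$ follows within \<open>N\<close> letters.  A
  sparse set of positions leaves finitely many possibilities for \<open>j\<close>.
\<close>
lemma finitely_many_crossings:
  assumes p: "follows (path P) p" "p \<in> sphere 0 1" and r: "r \<in> exterior" "r \<in> sphere 0 1"
    and P: "sparse P"
  obtains F where "finite F" "F \<subseteq> words"
    "\<And>\<delta>. \<delta> \<in> words \<Longrightarrow> \<delta> p \<in> barrier N \<Longrightarrow> \<delta> r \<notin> barrier N \<Longrightarrow> \<exists>f\<in>F. \<forall>z\<in>cball 0 1. \<delta> z = f z"
proof -
  \<comment> \<open>A turn at position \<open>i\<close> is followed by one at \<open>j + n = Suc i + n\<close>, hence the bound \<open>Suc N\<close>.\<close>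
  define J where "J = insert 0 (Suc ` {a \<in> P. \<exists>b\<in>P. a < b \<and> b \<le> a + Suc N})"
  define F where "F = (\<lambda>(l, j). (\<phi> Lg ^^ l) \<circ> bwd (path P) j) ` ({..N} \<times> J)"
  have cross: "(\<phi> Lg ^^ l) \<circ> bwd (path P) j \<in> F"
    if l: "l \<le> N" "bwd (path P) j p \<in> barrier (N - l)" "bwd (path P) j r \<notin> barrier (N - l)" for l j
  proof -
    have "j \<in> J"
    proof (cases j)
      case (Suc i)
      have "path P i \<noteq> Lg"
      proof
        assume "path P i = Lg"
        then have "bwd (path P) j r \<in> half_disc Lg'"
          using bwd_exterior[OF reduced_path r(1), of P i] Suc by simp
        then show False using barrier_half_discs(1) words_sphere[OF bwd_words r(2)] l(3) by blast
      qed
      then have "i \<in> P" by (auto simp: path_def split: if_splits)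
      moreover obtain n where "n \<le> N - l" "j + n \<in> P" using barrier_imp_turn[OF p l(2)] by blast
      ultimately have "i \<in> {a \<in> P. \<exists>b\<in>P. a < b \<and> b \<le> a + Suc N}"
        using Suc by (auto intro!: bexI[of _ "j + n"])
      then show ?thesis unfolding J_def Suc by blast
    qed (simp add: J_def)
    then show ?thesis unfolding F_def using l(1) by force
  qed
  show thesis
  proof (rule that)
    have "finite {a \<in> P. \<exists>b\<in>P. a < b \<and> b \<le> a + Suc N}" using P unfolding sparse_def by blast
    then show "finite F" unfolding F_def J_def by blast
    show "F \<subseteq> words" unfolding F_def using comp_words[OF funpow_words bwd_words] by fast
    fix \<delta> assume \<delta>: "\<delta> \<in> words" "\<delta> p \<in> barrier N" "\<delta> r \<notin> barrier N"
    have pr: "p \<in> cball 0 1" "r \<in> cball 0 1" using p r by auto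
    from \<delta>(1) show "\<exists>f\<in>F. \<forall>z\<in>cball 0 1. \<delta> z = f z"
    proof (cases rule: words_cases_along[where x = "path P"])
      case (along j)
      then have "bwd (path P) j \<in> F" using cross[of 0 j] \<delta> pr by simp
      then show ?thesis using along by blast
    next
      case (branch c \<delta>')
      then have "\<delta>' p \<in> barrier N" "\<delta>' r \<notin> barrier N" using \<delta> pr by auto
      from branch_crossing_barrier[OF branch(1) p r this] have "\<delta>' \<in> F" using cross by blast
      then show ?thesis using branch by blast
    qed
  qed
qed

end

section \<open>Topology of the barriers\<close>

text \<open>
  The arc is the radial projection of an open convex cone that does not contain the origin.
\<close>
lemma connected_cap: "connected {z::complex. norm z = 1 \<and> 1 < a * Re z}"
proof -
  let ?Q = "{z::complex. norm z < a * Re z}"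
  have "convex ?Q"
  proof (rule convexI, simp)
    fix x y :: complex and k l :: real
    assume xy: "norm x < a * Re x" "norm y < a * Re y" and kl: "0 \<le> k" "0 \<le> l" "k + l = 1"
    have "norm (of_real k * x + of_real l * y) \<le> k * norm x + l * norm y"
      using norm_triangle_ineq[of "of_real k * x" "of_real l * y"] kl by (simp add: norm_mult)
    moreover have "k * norm x + l * norm y < k * (a * Re x) + l * (a * Re y)"
    proof (cases "k = 0")
      case False
      then have "k * norm x < k * (a * Re x)" using kl xy by simp
      then show ?thesis using mult_left_mono[of "norm y" "a * Re y" l] kl xy by simp
    qed (use kl xy in simp)
    ultimately show "norm (k *\<^sub>R x + l *\<^sub>R y) < a * (k * Re x + l * Re y)"
      unfolding scaleR_conv_of_real by (simp add: algebra_simps)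
  qed
  then have "connected (sgn ` ?Q)"
    by (intro connected_continuous_image convex_connected continuous_on_sgn continuous_on_id) auto
  also have "sgn ` ?Q = {z::complex. norm z = 1 \<and> 1 < a * Re z}"
  proof (intro equalityI subsetI)
    fix z assume "z \<in> sgn ` ?Q"
    then obtain y where y: "norm y < a * Re y" "z = sgn y" by auto
    have "y \<noteq> 0" using y(1) by auto
    then have "norm z = 1" using y(2) by (simp add: norm_sgn)
    moreover have "Re z = Re y / norm y" using y(2) by (simp add: sgn_eq)
    then have "1 < a * Re z" using y(1) \<open>y \<noteq> 0\<close> by (simp add: less_divide_eq)
    ultimately show "z \<in> {z. norm z = 1 \<and> 1 < a * Re z}" by simp
  next
    fix z :: complex assume z: "z \<in> {z. norm z = 1 \<and> 1 < a * Re z}"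
    then have "sgn z = z" by (simp add: sgn_eq)
    then show "z \<in> sgn ` ?Q" using z by (intro image_eqI[of _ _ z]) auto
  qed
  finally show ?thesis .
qed

lemma connected_half_circle_cut:
  fixes s t :: real
  assumes "t \<noteq> 0"
  shows "connected {z::complex. norm z = 1 \<and> 0 < t * Im z \<and> s * Re z < 1}"
proof -
  let ?I = "{-1<..<1} \<inter> {x. s * x < 1}"
  define f where "f = (\<lambda>x. Complex x (sgn t * sqrt (1 - x\<^sup>2)))"
  have "convex {x. s * x < 1}" using convex_halfspace_lt[of s 1] by (simp add: inner_real_def)
  then have "convex ?I" by (intro convex_Int) auto
  moreover have "continuous_on ?I f"
    unfolding f_def by (intro continuous_intros)
  ultimately have "connected (f ` ?I)"
    by (intro connected_continuous_image convex_connected)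
  also have "f ` ?I = {z::complex. norm z = 1 \<and> 0 < t * Im z \<and> s * Re z < 1}"
  proof (intro equalityI subsetI)
    fix z assume "z \<in> f ` ?I"
    then obtain x where x: "-1 < x" "x < 1" "s * x < 1" "z = f x" by auto
    then have x2: "x\<^sup>2 < 1" by (simp add: abs_square_less_1 abs_less_iff)
    have "(sgn t)\<^sup>2 = 1" using assms by (simp add: sgn_if)
    then have "norm z = 1" unfolding x f_def cmod_def using x2 by (simp add: power_mult_distrib)
    moreover have "0 < t * (sgn t * sqrt (1 - x\<^sup>2))"
    proof -
      have "t * (sgn t * sqrt (1 - x\<^sup>2)) = \<bar>t\<bar> * sqrt (1 - x\<^sup>2)" by (simp add: sgn_if)
      moreover have "0 < \<bar>t\<bar> * sqrt (1 - x\<^sup>2)" using x2 assms by simp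
      ultimately show ?thesis by (simp only:)
    qed
    ultimately show "z \<in> {z. norm z = 1 \<and> 0 < t * Im z \<and> s * Re z < 1}" using x by (simp add: f_def)
  next
    fix z assume "z \<in> {z::complex. norm z = 1 \<and> 0 < t * Im z \<and> s * Re z < 1}"
    then have z: "norm z = 1" "0 < t * Im z" "s * Re z < 1" by auto
    have n: "(Re z)\<^sup>2 + (Im z)\<^sup>2 = 1" using z(1) cmod_power2[of z] by simp
    have "Im z \<noteq> 0" using z(2) by auto
    then have "(Re z)\<^sup>2 < 1" using n zero_less_power2[of "Im z"] by linarith
    then have "Re z \<in> ?I" using z(3) by (simp add: abs_square_less_1 abs_less_iff)
    moreover have "z = f (Re z)"
    proof -
      have "1 - (Re z)\<^sup>2 = (Im z)\<^sup>2" using n by simp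
      then have "f (Re z) = Complex (Re z) (sgn t * \<bar>Im z\<bar>)" unfolding f_def by simp
      moreover have "sgn t * \<bar>Im z\<bar> = Im z" using z(2) by (auto simp: sgn_if zero_less_mult_iff)
      ultimately show ?thesis by (simp add: complex_eq_iff)
    qed
    ultimately show "z \<in> f ` ?I" by (rule image_eqI[rotated])
  qed
  finally show ?thesis .
qed

text \<open>
  For points of the closed disc, \<open>1 - cnj w * z\<close> vanishes only if \<open>z = w\<close> is on the circle.
\<close>
lemma compact_nondegenerate:
  fixes E K :: "complex set"
  assumes "compact E" "compact K" "E \<subseteq> cball 0 1" "K \<subseteq> cball 0 1" and disj: "E \<inter> K \<inter> sphere 0 1 = {}"
  obtains \<eta> where "0 < \<eta>" "\<And>z w. z \<in> E \<Longrightarrow> w \<in> K \<Longrightarrow> \<eta> \<le> norm (1 - cnj w * z)"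
proof (cases "E \<times> K = {}")
  case True
  then show ?thesis using that[of 1] by auto
next
  case False
  have "continuous_on (E \<times> K) (\<lambda>x. norm (1 - cnj (snd x) * fst x))" by (intro continuous_intros)
  then obtain x where x: "x \<in> E \<times> K" "\<And>y. y \<in> E \<times> K \<Longrightarrow> norm (1 - cnj (snd x) * fst x) \<le> norm (1 - cnj (snd y) * fst y)"
    using continuous_attains_inf[OF compact_Times[OF assms(1,2)] False] by blast
  obtain z w where zw: "x = (z, w)" "z \<in> E" "w \<in> K" using x(1) by auto
  have "1 - cnj w * z \<noteq> 0"
  proof
    assume a: "1 - cnj w * z = 0"
    have n: "norm z \<le> 1" "norm w \<le> 1" using zw assms by auto
    have "norm w * norm z = 1" using a by (metis complex_mod_cnj eq_iff_diff_eq_0 norm_mult norm_one)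
    then have w1: "norm w = 1" using n mult_left_le[of "norm z" "norm w"] by simp
    then have z1: "norm z = 1" using \<open>norm w * norm z = 1\<close> by simp
    have "w * cnj w = 1" using w1 complex_norm_square[of w] by simp
    then have "z = w * (cnj w * z)" by (simp only: mult.assoc[symmetric] mult_1_left)
    moreover have "cnj w * z = 1" using a by simp
    ultimately have "z = w" by (simp only: mult_1_right)
    then show False using zw disj z1 by auto
  qed
  then show ?thesis using that[of "norm (1 - cnj w * z)"] x(2) zw by auto
qed

context schottky
begin

lemma continuous_circle_power: "continuous_on A (circle_power c)"
  unfolding circle_power_def[abs_def] by (intro continuous_intros)

lemma words_continuous: "f \<in> words \<Longrightarrow> continuous_on (cball 0 1) f"
  using unit_disc_moebius_continuous[OF words_moebius] .

lemma words_continuous_sphere: "f \<in> words \<Longrightarrow> continuous_on (sphere 0 1) f"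
  using words_continuous continuous_on_subset sphere_cball by blast

lemma compact_closed_arc: "compact {z \<in> sphere 0 1. circle_power c z \<le> 0}"
proof -
  have "compact (sphere 0 1 \<inter> {z. circle_power c z \<le> 0})"
    by (intro compact_Int_closed closed_Collect_le continuous_circle_power continuous_on_const) auto
  then show ?thesis by (simp add: Int_def)
qed

lemma openin_barrier: "open_in_circle (barrier N)"
proof -
  let ?K = "(\<phi> Lg ^^ N) ` {z \<in> sphere 0 1. circle_power (center Lg) z \<le> 0}"
  have "continuous_on {z \<in> sphere 0 1. circle_power (center Lg) z \<le> 0} (\<phi> Lg ^^ N)"
    using words_continuous_sphere[OF funpow_words] by (rule continuous_on_subset) auto
  then have "closed ?K" by (intro compact_imp_closed compact_continuous_image compact_closed_arc)
  then have "open ({z. circle_power (center Lg') z < 0} \<union> ({z. 0 < t * Im z} \<inter> - ?K))"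
    by (intro open_Un open_Int open_Compl open_Collect_less continuous_circle_power continuous_intros)
  moreover have "barrier N = sphere 0 1 \<inter> ({z. circle_power (center Lg') z < 0} \<union> ({z. 0 < t * Im z} \<inter> - ?K))"
    unfolding barrier_def by blast
  ultimately show ?thesis by (simp only: openin_open_Int)
qed

text \<open>
  The barrier is the union of the arc of $g^{-1}$ and of the image under $g^N$ of the part of the upper
  half circle outside the arc of $g$, where the upper half is the one on the side of $h$.  These two
  arcs overlap in the upper part of the first.
\<close>
lemma connected_barrier: "connected (barrier N)"
proof -
  let ?C = "{z \<in> sphere 0 1. circle_power (center Lg) z \<le> 0}"
  let ?A = "{z \<in> sphere 0 1. circle_power (center Lg') z < 0}"
  let ?B = "{z \<in> sphere 0 1. 0 < t * Im z \<and> z \<notin> (\<phi> Lg ^^ N) ` ?C}"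
  let ?U = "{z. norm z = 1 \<and> 0 < t * Im z \<and> s * Re z < 1}"
  let ?f = "\<phi> Lg ^^ N"
  have t0: "t \<noteq> 0" using centers by auto
  have f: "?f \<in> words" by (rule funpow_words)
  obtain f' where f': "f' \<in> words" "\<And>z. z \<in> cball 0 1 \<Longrightarrow> f' (?f z) = z" "\<And>z. z \<in> cball 0 1 \<Longrightarrow> ?f (f' z) = z"
    using words_inverse[OF f] by blast
  have upper: "0 < t * Im (?f z) \<longleftrightarrow> 0 < t * Im z" if "z \<in> cball 0 1" for z
  proof (induction N)
    case (Suc N)
    have "(\<phi> Lg ^^ N) z \<in> cball 0 1" using words_maps_to[OF funpow_words that] .
    then show ?case using Suc phi_Lg_Im_sign by simp
  qed simp
  have A: "?A = {z. norm z = 1 \<and> 1 < s' * Re z}"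
    using circle_power_sphere(1)[of _ s'] by auto
  have B: "?B = ?f ` ?U"
  proof (intro equalityI subsetI)
    fix z assume z: "z \<in> ?B"
    then have zc: "z \<in> cball 0 1" by auto
    have z': "f' z \<in> sphere 0 1" using words_sphere[OF f'(1)] z by blast
    then have z'c: "f' z \<in> cball 0 1" by auto
    have "f' z \<notin> ?C" using z f'(3)[OF zc] by (metis (no_types, lifting) image_eqI mem_Collect_eq)
    then have "0 < circle_power (of_real s) (f' z)" using z' by auto
    then have "s * Re (f' z) < 1" using circle_power_sphere(1)[of "f' z" s] z' by simp
    moreover have "0 < t * Im (f' z)" using upper[OF z'c] f'(3)[OF zc] z by simp
    ultimately have "f' z \<in> ?U" using z' by simp
    then show "z \<in> ?f ` ?U" using f'(3)[OF zc] by (metis (no_types, lifting) image_eqI)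
  next
    fix z assume "z \<in> ?f ` ?U"
    then obtain y where y: "norm y = 1" "0 < t * Im y" "s * Re y < 1" "z = ?f y" by blast
    then have yc: "y \<in> sphere 0 1" "y \<in> cball 0 1" by auto
    have "z \<notin> ?f ` ?C"
    proof
      assume "z \<in> ?f ` ?C"
      then obtain x where xC: "z = ?f x" "x \<in> ?C" by (rule imageE)
      have x: "x \<in> ?C" "?f y = ?f x" using xC(2) trans[OF y(4)[symmetric] xC(1)] .
      then have "x \<in> cball 0 1" by auto
      have "y = f' (?f y)" using f'(2)[OF yc(2)] by (rule sym)
      also have "\<dots> = x" unfolding x(2) using f'(2)[OF \<open>x \<in> cball 0 1\<close>] .
      finally have "y = x" .
      then show False using x(1) y circle_power_sphere(1)[of y s] by simp
    qed
    moreover have "z \<in> sphere 0 1" using words_sphere[OF f yc(1)] y(4) by simp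
    moreover have "0 < t * Im z" using upper[OF yc(2)] y by simp
    ultimately show "z \<in> ?B" by blast
  qed
  have "continuous_on ?U ?f"
    using words_continuous[OF f] by (rule continuous_on_subset) auto
  then have "connected ?B"
    unfolding B using connected_half_circle_cut[OF t0] by (rule connected_continuous_image)
  moreover have "connected ?A" unfolding A by (rule connected_cap)
  moreover have "?A \<inter> ?B \<noteq> {}"
  proof -
    have s': "0 < 1 / \<bar>s'\<bar>" "1 / \<bar>s'\<bar> < 1" using centers(2) by (simp_all add: divide_less_eq)
    \<comment> \<open>The real part of a common point, up to sign.\<close>
    obtain k where k: "1 / \<bar>s'\<bar> < k" and "k < 1" using dense[OF s'(2)] by blast
    have "0 < k" using s'(1) k by (rule less_trans)
    from \<open>0 < k\<close> \<open>k < 1\<close> have k2: "k\<^sup>2 < 1" by (simp add: power_less_one_iff)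
    have sg: "(sgn s')\<^sup>2 = 1" "(sgn t)\<^sup>2 = 1" using centers by (auto simp: sgn_if)
    define z where "z = Complex (sgn s' * k) (sgn t * sqrt (1 - k\<^sup>2))"
    have z1: "norm z = 1" unfolding z_def cmod_def using sg k2 by (simp add: power_mult_distrib)
    have "s' * Re z = \<bar>s'\<bar> * k" unfolding z_def by (simp add: sgn_if)
    also have "\<dots> > 1" using k centers(2) by (simp add: divide_less_eq mult.commute)
    finally have "z \<in> ?A" unfolding A using z1 by simp
    moreover have "t * Im z = \<bar>t\<bar> * sqrt (1 - k\<^sup>2)" unfolding z_def by (simp add: sgn_if)
    then have "0 < t * Im z" using k2 t0 by simp
    moreover have "z \<notin> ?f ` ?C"
      using funpow_cap[of z N] \<open>z \<in> ?A\<close> closed_half_discs_disjoint[of Lg' Lg z] by auto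
    ultimately show ?thesis by blast
  qed
  ultimately show ?thesis unfolding barrier_def by (intro connected_Un)
qed

text \<open>
  A compact set that contains all barriers at once and still avoids the closed half-disc of $h^{-1}$.
  The origin is included so that its orbit is controlled by the same estimate.
\<close>
definition barrier_hull :: "complex set" where
  "barrier_hull = insert 0 {z \<in> sphere 0 1. 0 \<le> t * Im z \<or> circle_power (center Lg') z \<le> 0}"

lemma barrier_subset_hull: "barrier N \<subseteq> barrier_hull"
  unfolding barrier_def barrier_hull_def by auto

lemma barrier_hull_nondegenerate:
  obtains \<eta> where "0 < \<eta>"
    "\<And>z w. z \<in> barrier_hull \<Longrightarrow> w \<in> half_disc Lh' \<Longrightarrow> \<eta> \<le> norm (1 - cnj w * z)"
proof -
  let ?K = "cball 0 1 \<inter> {z. circle_power (center Lh') z \<le> 0}"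
  have hull: "barrier_hull = insert 0 (sphere 0 1 \<inter> ({z. 0 \<le> t * Im z} \<union> {z. circle_power (center Lg') z \<le> 0}))"
    unfolding barrier_hull_def by auto
  have "compact barrier_hull"
    unfolding hull
    by (intro compact_insert compact_Int_closed compact_sphere closed_Un closed_Collect_le
        continuous_circle_power continuous_intros)
  moreover have "compact ?K"
    by (intro compact_Int_closed compact_cball closed_Collect_le continuous_circle_power continuous_intros)
  moreover have "barrier_hull \<inter> ?K \<inter> sphere 0 1 = {}"
  proof -
    have False if z: "z \<in> barrier_hull" "circle_power (center Lh') z \<le> 0" "norm z = 1" for z
    proof -
      have "0 < circle_power (center Lg') z" using closed_half_discs_disjoint[of Lh' Lg' z] z(2) by simp
      moreover have "z \<noteq> 0" using z(3) by auto
      ultimately have up: "0 \<le> t * Im z" using z(1) unfolding barrier_hull_def by auto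
      have down: "1 \<le> t' * Im z" using z(2) circle_power_sphere(2)[OF z(3), of t'] by simp
      have "Im z \<noteq> 0" using down by auto
      moreover have "t \<noteq> 0" using centers(3) by auto
      ultimately have "0 < t * Im z" using up by (simp add: less_le)
      then have "0 < (t * Im z) * (t' * Im z)" using down by simp
      also have "\<dots> = (t * t') * (Im z)\<^sup>2" by (simp add: power2_eq_square)
      also have "\<dots> \<le> 0" using opposite(2) by (simp add: mult_nonpos_nonneg)
      finally show False by simp
    qed
    then show ?thesis by auto
  qed
  moreover have "barrier_hull \<subseteq> cball 0 1" unfolding barrier_hull_def by auto
  ultimately obtain \<eta> where "0 < \<eta>" "\<And>z w. z \<in> barrier_hull \<Longrightarrow> w \<in> ?K \<Longrightarrow> \<eta> \<le> norm (1 - cnj w * z)"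
    using compact_nondegenerate[of barrier_hull ?K] by blast
  then show thesis using that unfolding half_disc_def by fastforce
qed

section \<open>Points that are not concentration points\<close>

lemma half_disc_norm:
  assumes "z \<in> half_disc c"
  shows "1 < 2 * norm (center c) * norm z"
proof -
  have "1 + (norm z)\<^sup>2 < 2 * Re (cnj (center c) * z)"
    using assms unfolding half_disc_def circle_power_def by simp
  also have "\<dots> \<le> 2 * norm (cnj (center c) * z)" using complex_Re_le_cmod[of "cnj (center c) * z"] by linarith
  also have "\<dots> = 2 * norm (center c) * norm z" unfolding norm_mult complex_mod_cnj by simp
  finally show ?thesis using zero_le_power2[of "norm z"] by linarith
qed

text \<open>
  The longer prefix is the shorter one applied to a point of some half-disc.
\<close>
lemma fwd_separated:
  assumes "j < k"
  shows "(1 - (norm (fwd (path P) j 0))\<^sup>2) / (4 * (\<bar>s\<bar> + \<bar>t\<bar>)) \<le> norm (fwd (path P) k 0 - fwd (path P) j 0)"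
proof -
  define \<zeta> where "\<zeta> = fwd (\<lambda>i. path P (j + i)) (k - j) 0"
  have "reduced (\<lambda>i. path P (j + i))" unfolding reduced_def path_def by auto
  from fwd_exterior[OF this zero_exterior, of "k - j"]
  have \<zeta>: "\<zeta> \<in> half_disc (path P j)" using assms by (simp add: \<zeta>_def)
  have "fwd (path P) k = fwd (path P) (j + (k - j))" using assms by simp
  also have "\<dots> = fwd (path P) j \<circ> fwd (\<lambda>i. path P (j + i)) (k - j)" by (rule fwd_add)
  finally have eq: "fwd (path P) k 0 = fwd (path P) j \<zeta>" by (simp add: \<zeta>_def)
  have c: "norm (center (path P j)) \<le> \<bar>s\<bar> + \<bar>t\<bar>" by (auto simp: path_def norm_mult)
  have pos: "0 < \<bar>s\<bar> + \<bar>t\<bar>" using centers by linarith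
  have "1 < 2 * norm (center (path P j)) * norm \<zeta>" using half_disc_norm[OF \<zeta>] .
  also have "\<dots> \<le> 2 * (\<bar>s\<bar> + \<bar>t\<bar>) * norm \<zeta>" using c by (intro mult_right_mono mult_left_mono) auto
  finally have "1 / (2 * (\<bar>s\<bar> + \<bar>t\<bar>)) \<le> norm \<zeta>"
    using pos by (simp add: divide_le_eq mult.commute)
  moreover have "0 \<le> 1 - (norm (fwd (path P) j 0))\<^sup>2"
    using unit_disc_moebius_norm(1)[OF words_moebius[OF fwd_words], of 0] by (simp add: power_le_one)
  ultimately have "1 / (2 * (\<bar>s\<bar> + \<bar>t\<bar>)) * (1 - (norm (fwd (path P) j 0))\<^sup>2) / 2 \<le>
      norm \<zeta> * (1 - (norm (fwd (path P) j 0))\<^sup>2) / 2"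
    by (intro divide_right_mono mult_right_mono) auto
  also have "\<dots> \<le> norm (fwd (path P) j \<zeta> - fwd (path P) j 0)"
  proof (rule unit_disc_moebius_separation[OF words_moebius[OF fwd_words]])
    show "norm \<zeta> \<le> 1" using \<zeta> unfolding half_disc_def by simp
  qed
  finally show ?thesis unfolding eq by simp
qed

text \<open>
  The images of \<open>0\<close> under the prefixes have a convergent subsequence.  Its consecutive terms come
  close to each other, which \<open>fwd_separated\<close> permits only near the circle.
\<close>
lemma orbit_approaches_circle:
  assumes "infinite P" "0 < e"
  shows "\<exists>i\<in>P. 1 - (norm (fwd (path P) (Suc i) 0))\<^sup>2 < e"
proof -
  define Z where "Z = (\<lambda>k. fwd (path P) (Suc (enumerate P k)) 0)"
  have "Z k \<in> cball 0 1" for k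
    unfolding Z_def by (rule fwd_X) simp
  then obtain l r where r: "strict_mono (r :: nat \<Rightarrow> nat)" "(Z \<circ> r) \<longlonglongrightarrow> l"
    using compact_cball[of "0::complex" 1] unfolding compact_def by blast
  define M where "M = 4 * (\<bar>s\<bar> + \<bar>t\<bar>)"
  have M: "0 < M" unfolding M_def using centers(1) by simp
  have "(\<lambda>k. (Z \<circ> r) (Suc k) - (Z \<circ> r) k) \<longlonglongrightarrow> l - l"
    using r(2) by (intro tendsto_diff LIMSEQ_Suc)
  then have "(\<lambda>k. norm ((Z \<circ> r) (Suc k) - (Z \<circ> r) k)) \<longlonglongrightarrow> 0"
    by (simp add: tendsto_norm_zero)
  then have "\<forall>\<^sub>F k in sequentially. norm ((Z \<circ> r) (Suc k) - (Z \<circ> r) k) < e / M"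
    using \<open>0 < e\<close> M by (intro order_tendstoD(2)) auto
  then obtain k where k: "norm (Z (r (Suc k)) - Z (r k)) < e / M"
    unfolding comp_apply using eventually_happens'[OF sequentially_bot] by blast
  have "enumerate P (r k) < enumerate P (r (Suc k))"
    using r(1) assms(1) by (intro enumerate_mono) (auto simp: strict_mono_def)
  then have "(1 - (norm (Z (r k)))\<^sup>2) / M \<le> norm (Z (r (Suc k)) - Z (r k))"
    unfolding Z_def M_def by (intro fwd_separated) simp
  with k have "(1 - (norm (Z (r k)))\<^sup>2) / M < e / M" by linarith
  then have "1 - (norm (Z (r k)))\<^sup>2 < e" using M by (simp add: divide_less_cancel)
  then show ?thesis unfolding Z_def using enumerate_in_set[OF assms(1)] by blast
qed

lemma next_turn:
  assumes "infinite (P :: nat set)"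
  obtains n where "j + n \<in> P" "\<And>i. i < n \<Longrightarrow> j + i \<notin> P"
proof -
  obtain b where "b \<in> P" "j \<le> b"
    using assms unfolding infinite_nat_iff_unbounded_le by blast
  then obtain k where "j + k \<in> P" using le_Suc_ex by blast
  then have ex: "\<exists>n. j + n \<in> P" by (rule exI)
  show thesis
    using that[of "LEAST n. j + n \<in> P"] LeastI_ex[OF ex] not_less_Least[of _ "\<lambda>n. j + n \<in> P"] by blast
qed

text \<open>
  The prefix ends with $h$, so its inverse moves \<open>0\<close> into the half-disc of $h^{-1}$, away from the hull;
  the contraction estimate applies to the hull, which contains the preimage of \<open>p\<close>.
\<close>
lemma hull_shrinks:
  assumes P: "infinite P" and p: "follows (path P) p" "p \<in> sphere 0 1" and "0 < e"
  shows "\<exists>i\<in>P. \<forall>z\<in>barrier_hull. dist (fwd (path P) (Suc i) z) p < e"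
proof -
  obtain \<eta> where \<eta>: "0 < \<eta>"
    "\<And>z w. z \<in> barrier_hull \<Longrightarrow> w \<in> half_disc Lh' \<Longrightarrow> \<eta> \<le> norm (1 - cnj w * z)"
    using barrier_hull_nondegenerate by blast
  have "0 < e * \<eta>\<^sup>2 / 2" using \<open>0 < e\<close> \<eta>(1) by simp
  then obtain i where i: "i \<in> P" "1 - (norm (fwd (path P) (Suc i) 0))\<^sup>2 < e * \<eta>\<^sup>2 / 2"
    using orbit_approaches_circle[OF P] by blast
  let ?f = "fwd (path P) (Suc i)"
  define w where "w = bwd (path P) (Suc i) 0"
  have f: "unit_disc_moebius ?f" using words_moebius[OF fwd_words] .
  have w1: "norm w < 1" unfolding w_def by (rule unit_disc_moebius_norm(3)[OF words_moebius[OF bwd_words]]) simp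
  have w0: "?f w = 0" unfolding w_def by (rule fwd_bwd) simp
  have "path P i = Lh" using i(1) by (simp add: path_def)
  then have "opp (path P i) = Lh'" by simp
  then have wh: "w \<in> half_disc Lh'"
    using bwd_exterior[OF reduced_path zero_exterior, of P i] unfolding w_def by metis
  obtain n where "Suc i + n \<in> P" "\<And>k. k < n \<Longrightarrow> Suc i + k \<notin> P" using next_turn[OF P] by blast
  then have "bwd (path P) (Suc i) p \<in> barrier n" using turn_imp_barrier[OF p] by blast
  then have q: "bwd (path P) (Suc i) p \<in> barrier_hull" using barrier_subset_hull by blast
  have pc: "p \<in> cball 0 1" using p(2) by auto
  have "dist (?f z) p < e" if z: "z \<in> barrier_hull" for z
  proof -
    have n: "norm z \<le> 1" "norm (bwd (path P) (Suc i) p) \<le> 1"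
      using z q unfolding barrier_hull_def by auto
    have "dist (?f z) p = norm (?f z - ?f (bwd (path P) (Suc i) p))"
      using fwd_bwd[OF pc, of "path P" "Suc i"] by (simp only: dist_norm)
    also have "\<dots> \<le> 2 * (1 - (norm (?f 0))\<^sup>2) / \<eta>\<^sup>2"
      by (rule unit_disc_moebius_contraction[OF f w1 w0 \<eta>(1) n \<eta>(2)[OF z wh] \<eta>(2)[OF q wh]])
    also have "\<dots> < 2 * (e * \<eta>\<^sup>2 / 2) / \<eta>\<^sup>2"
      using i(2) \<eta>(1) by (intro divide_strict_right_mono mult_strict_left_mono) auto
    also have "\<dots> = e" using \<eta>(1) by simp
    finally show ?thesis .
  qed
  then show ?thesis using i(1) by blast
qed

text \<open>
  The arc \<open>U\<close> is a translated barrier whose length \<open>n\<close> is the exponent of $g$ at its place.  The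
  neighbourhood \<open>V\<close> omits a point \<open>r\<close> outside all half-discs.  If \<open>\<gamma>\<close> maps \<open>U\<close> into \<open>V\<close> and \<open>p\<close> is in
  \<open>\<gamma> ` U\<close>, then \<open>\<delta>\<close>, the inverse of \<open>\<gamma> \<circ> fwd (path P) m\<close>, moves \<open>p\<close> but not \<open>r\<close> into the barrier, so it
  is one of finitely many maps \<open>f\<close>.  For each \<open>f\<close>, the set \<open>V\<close> also omits the preimages under \<open>f\<close> of two
  points of the barrier, except \<open>p\<close>; both preimages would then have to be \<open>p\<close>.
\<close>
lemma not_concentrated:
  assumes P: "infinite P" "sparse P" and p: "follows (path P) p" "p \<in> sphere 0 1"
    and W: "open_in_circle W" "p \<in> W"
  obtains U V where "open_in_circle U" "connected U" "p \<in> U" "U \<subseteq> W" "open_in_circle V" "p \<in> V"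
    "\<And>\<gamma>. \<gamma> \<in> words \<Longrightarrow> p \<in> \<gamma> ` U \<Longrightarrow> \<not> \<gamma> ` U \<subseteq> V"
proof -
  have pc: "p \<in> cball 0 1" using p(2) by auto
  obtain T where T: "open T" "W = sphere 0 1 \<inter> T" using W(1) unfolding openin_open by blast
  then obtain e where e: "0 < e" "ball p e \<subseteq> T" using W(2) openE by blast
  obtain i where i: "i \<in> P" "\<And>z. z \<in> barrier_hull \<Longrightarrow> dist (fwd (path P) (Suc i) z) p < e"
    using hull_shrinks[OF P(1) p e(1)] by blast
  define m where "m = Suc i"
  let ?f = "fwd (path P) m" and ?b = "bwd (path P) m"
  obtain n where n: "m + n \<in> P" "\<And>k. k < n \<Longrightarrow> m + k \<notin> P" using next_turn[OF P(1)] by blast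
  have pb: "?b p \<in> barrier n" using turn_imp_barrier[OF p n] .
  have bar: "z \<in> sphere 0 1" "z \<in> cball 0 1" if "z \<in> barrier n" for z
    using that unfolding barrier_def by auto
  define U where "U = ?f ` barrier n"
  have f_words: "?f \<in> words" and b_words: "?b \<in> words" by (rule fwd_words bwd_words)+
  have U_eq: "U = sphere 0 1 \<inter> ?b -` barrier n"
  proof (intro equalityI subsetI)
    fix z assume "z \<in> U"
    then obtain y where y: "y \<in> barrier n" "z = ?f y" unfolding U_def by blast
    then show "z \<in> sphere 0 1 \<inter> ?b -` barrier n"
      using words_sphere[OF f_words bar(1)[OF y(1)]] bwd_fwd[OF bar(2)[OF y(1)], of "path P" m] by auto
  next
    fix z assume z: "z \<in> sphere 0 1 \<inter> ?b -` barrier n"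
    then have "z \<in> cball 0 1" by auto
    then have "z = ?f (?b z)" using fwd_bwd by metis
    then show "z \<in> U" unfolding U_def using z by blast
  qed
  have U_open: "open_in_circle U" unfolding U_eq
    using words_sphere[OF b_words]
    by (intro continuous_openin_preimage[OF words_continuous_sphere[OF b_words] _ openin_barrier]) blast
  have U_conn: "connected U" unfolding U_def
  proof (rule connected_continuous_image[OF _ connected_barrier])
    show "continuous_on (barrier n) ?f"
      using words_continuous[OF f_words] by (rule continuous_on_subset) (use bar in blast)
  qed
  have pU: "p \<in> U" unfolding U_eq using pb p(2) by blast
  have UW: "U \<subseteq> W"
  proof
    fix z assume z: "z \<in> U"
    then obtain y where "y \<in> barrier n" "z = ?f y" unfolding U_def by blast
    then have "dist z p < e" using i(2) barrier_subset_hull unfolding m_def by blast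
    then show "z \<in> W" using e(2) z U_eq T(2) by (auto simp: dist_commute)
  qed
  obtain r where r: "r \<in> exterior" "norm r = 1" by (rule exterior_on_circle)
  have rs: "r \<in> sphere 0 1" using r(2) by simp
  obtain F where F: "finite F" "F \<subseteq> words"
    "\<And>\<delta>. \<delta> \<in> words \<Longrightarrow> \<delta> p \<in> barrier n \<Longrightarrow> \<delta> r \<notin> barrier n \<Longrightarrow> \<exists>f\<in>F. \<forall>z\<in>cball 0 1. \<delta> z = f z"
    using finitely_many_crossings[OF p r(1) rs P(2)] by blast
  have "\<forall>f\<in>F. \<exists>f'. \<forall>z\<in>cball 0 1. f' (f z) = z"
    using F(2) words_inverse by blast
  then obtain h where h: "\<And>f z. f \<in> F \<Longrightarrow> z \<in> cball 0 1 \<Longrightarrow> h f (f z) = z" by metis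
  \<comment> \<open>Two distinct points, in the arcs of $h$ and of $g^{-1}$.\<close>
  obtain x y where xy: "x \<in> barrier n" "y \<in> barrier n" "x \<noteq> y"
  proof -
    define x where "x = bwd (path P) (m + n) p"
    have "path P (m + n) = Lh" using n(1) by (simp add: path_def)
    then have x: "x \<in> sphere 0 1" "x \<in> half_disc Lh"
      using follows_sphere_step(1,2)[OF p, of "m + n"] unfolding x_def by metis+
    have y: "\<phi> Lg' x \<in> half_disc Lg'" using ping[of Lh Lg' x] x(2) by simp
    have "x \<noteq> \<phi> Lg' x" using y x(2) D_disjoint[of Lh Lg'] by auto
    then show thesis
      using that[of x "\<phi> Lg' x"] barrier_half_discs(2)[OF x] barrier_half_discs(1)[OF phi_sphere[OF x(1)] y] by blast
  qed
  \<comment> \<open>The point \<open>p\<close> itself must stay in \<open>V\<close>; at most one of \<open>x\<close> and \<open>y\<close> is moved to it by a given map.\<close>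
  define B where "B = insert r (((\<lambda>f. h f x) ` F \<union> (\<lambda>f. h f y) ` F) - {p})"
  define V where "V = sphere 0 1 - B"
  have "finite B" unfolding B_def using F(1) by simp
  then have "open (- B)" by (intro open_Compl finite_imp_closed)
  moreover have "V = sphere 0 1 \<inter> - B" unfolding V_def by blast
  ultimately have V_open: "open_in_circle V" by (simp only: openin_open_Int)
  have "p \<noteq> r"
  proof
    assume "p = r"
    then have "0 < circle_power (center (path P 0)) p" using r(1) unfolding exterior_iff by blast
    moreover have "circle_power (center (path P 0)) p < 0"
      using follows_sphere_step(2)[OF p, of 0] by (simp add: half_disc_def)
    ultimately show False by simp
  qed
  then have pV: "p \<in> V" unfolding V_def B_def using p(2) by simp
  show thesis
  proof (rule that[OF U_open U_conn pU UW V_open pV], rule notI)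
    fix \<gamma> assume \<gamma>: "\<gamma> \<in> words" "p \<in> \<gamma> ` U" "\<gamma> ` U \<subseteq> V"
    obtain \<gamma>' where \<gamma>': "\<gamma>' \<in> words" "\<And>z. z \<in> cball 0 1 \<Longrightarrow> \<gamma>' (\<gamma> z) = z" "\<And>z. z \<in> cball 0 1 \<Longrightarrow> \<gamma> (\<gamma>' z) = z"
      using words_inverse[OF \<gamma>(1)] by blast
    define \<delta> where "\<delta> = ?b \<circ> \<gamma>'"
    have \<delta>: "\<delta> \<in> words" unfolding \<delta>_def using b_words \<gamma>'(1) by (rule comp_words)
    have \<delta>_inv: "\<delta> (\<gamma> (?f z)) = z" if "z \<in> cball 0 1" for z
    proof -
      have "\<gamma>' (\<gamma> (?f z)) = ?f z" using \<gamma>'(2) fwd_X[OF that] by blast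
      then show ?thesis unfolding \<delta>_def comp_apply using bwd_fwd[OF that] by simp
    qed
    have inv_\<delta>: "\<gamma> (?f (\<delta> z)) = z" if "z \<in> cball 0 1" for z
    proof -
      have "\<gamma>' z \<in> cball 0 1" using words_maps_to[OF \<gamma>'(1) that] .
      then have "?f (\<delta> z) = \<gamma>' z" unfolding \<delta>_def comp_apply by (rule fwd_bwd)
      then show ?thesis using \<gamma>'(3)[OF that] by simp
    qed
    have img: "\<gamma> (?f z) \<in> V" "\<gamma> (?f z) \<in> cball 0 1" if "z \<in> barrier n" for z
    proof -
      show "\<gamma> (?f z) \<in> V" using that \<gamma>(3) unfolding U_def by blast
      then show "\<gamma> (?f z) \<in> cball 0 1" unfolding V_def by auto
    qed
    obtain b where b: "b \<in> barrier n" "p = \<gamma> (?f b)" using \<gamma>(2) unfolding U_def by blast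
    have "\<delta> p \<in> barrier n" unfolding b(2) using \<delta>_inv[OF bar(2)[OF b(1)]] b(1) by simp
    moreover have "\<delta> r \<notin> barrier n"
    proof
      assume "\<delta> r \<in> barrier n"
      from img(1)[OF this] have "r \<in> V" using inv_\<delta>[of r] rs by simp
      then show False unfolding V_def B_def by simp
    qed
    ultimately obtain f where f: "f \<in> F" "\<And>z. z \<in> cball 0 1 \<Longrightarrow> \<delta> z = f z" using F(3)[OF \<delta>] by blast
    have hf: "h f z = \<gamma> (?f z)" if "z \<in> barrier n" for z
    proof -
      have "f (\<gamma> (?f z)) = z" using f(2)[OF img(2)[OF that]] \<delta>_inv[OF bar(2)[OF that]] by simp
      then show ?thesis using h[OF f(1) img(2)[OF that]] by simp
    qed
    have "h f x = p" "h f y = p"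
      using img(1)[OF xy(1)] img(1)[OF xy(2)] f(1) unfolding hf[OF xy(1), symmetric] hf[OF xy(2), symmetric] V_def B_def
      by blast+
    then have "\<delta> (\<gamma> (?f x)) = \<delta> (\<gamma> (?f y))" using hf xy by simp
    then show False using \<delta>_inv bar(2) xy by metis
  qed
qed

text \<open>
  The images of the closed arcs under the prefixes are nested compact sets.  A point in all of them
  has the required itinerary: one more letter moves a closed arc into the open half-disc.
\<close>
lemma follows_path_exists:
  obtains p where "follows (path P) p" "p \<in> sphere 0 1"
proof -
  let ?x = "path P"
  define C where "C = (\<lambda>c. {z \<in> sphere 0 1. circle_power (center c) z \<le> 0})"
  define K where "K = (\<lambda>m. fwd ?x m ` C (?x m))"
  have Cc: "C c \<subseteq> cball 0 1" for c unfolding C_def by auto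
  have comp: "compact (K m)" for m
  proof -
    have "continuous_on (C (?x m)) (fwd ?x m)"
      using words_continuous[OF fwd_words] Cc by (rule continuous_on_subset)
    then show ?thesis unfolding K_def C_def by (intro compact_continuous_image compact_closed_arc)
  qed
  have "sgn (center (?x m)) \<in> C (?x m)" for m
  proof -
    have "circle_power c (sgn c) \<le> 0" if "1 < norm c" for c :: complex
    proof -
      have "c \<noteq> 0" using that by auto
      have "cnj c * sgn c = of_real ((norm c)\<^sup>2) / of_real (norm c)"
        unfolding complex_norm_square sgn_eq by (simp add: mult.commute)
      also have "\<dots> = of_real (norm c)" using \<open>c \<noteq> 0\<close> by (simp add: power2_eq_square)
      finally have "cnj c * sgn c = of_real (norm c)" .
      then show ?thesis unfolding circle_power_def using that \<open>c \<noteq> 0\<close> by (simp add: norm_sgn)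
    qed
    moreover have "1 < norm (center (?x m))" using centers by (simp add: path_def norm_mult)
    moreover from this have "center (?x m) \<noteq> 0" by auto
    ultimately show ?thesis unfolding C_def by (simp add: norm_sgn)
  qed
  then have ne: "K m \<noteq> {}" for m unfolding K_def by blast
  have step: "K (Suc m) \<subseteq> K m" for m
  proof
    fix z assume "z \<in> K (Suc m)"
    then obtain y where y: "y \<in> C (?x (Suc m))" "z = fwd ?x m (\<phi> (?x m) y)"
      unfolding K_def by auto
    have ys: "y \<in> sphere 0 1" "y \<in> cball 0 1" using y(1) unfolding C_def by auto
    have "0 < circle_power (center (opp (?x m))) y"
      using y(1) closed_half_discs_disjoint[of "?x (Suc m)" "opp (?x m)" y] reduced_path[of P]
      unfolding C_def reduced_def by auto
    then have "\<phi> (?x m) y \<in> C (?x m)"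
      using phi_half_disc[OF ys(2), of "?x m"] phi_sphere[OF ys(1)] unfolding C_def by simp
    then show "z \<in> K m" unfolding K_def using y(2) by blast
  qed
  have "\<Inter> (range K) \<noteq> {}"
    using comp ne lift_Suc_antimono_le[of K, OF step] by (rule compact_nest)
  then obtain p where p: "\<And>m. p \<in> K m" by blast
  have ps: "p \<in> sphere 0 1" using p[of 0] unfolding K_def C_def by auto
  then have pc: "p \<in> cball 0 1" by auto
  have bC: "bwd ?x m p \<in> C (?x m)" for m
  proof -
    obtain y where "y \<in> C (?x m)" "p = fwd ?x m y" using p[of m] unfolding K_def by blast
    then show ?thesis using bwd_fwd[of y] Cc by (metis subsetD)
  qed
  have "bwd ?x m p \<in> half_disc (?x m)" for m
  proof -
    \<comment> \<open>The closed arc at stage \<open>Suc m\<close> gives the open half-disc at stage \<open>m\<close>.\<close>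
    let ?y = "bwd ?x (Suc m) p"
    have yc: "?y \<in> cball 0 1" using bwd_X[OF pc] .
    have "0 < circle_power (center (opp (?x m))) ?y"
      using bC[of "Suc m"] closed_half_discs_disjoint[of "?x (Suc m)" "opp (?x m)" ?y] reduced_path[of P]
      unfolding C_def reduced_def by blast
    then have "\<phi> (?x m) ?y \<in> half_disc (?x m)"
      using phi_half_disc[OF yc, of "?x m"] phi_cball[OF yc] unfolding half_disc_def by blast
    then show ?thesis unfolding bwd_step[OF pc, symmetric] .
  qed
  then show thesis using that[of p] pc ps unfolding follows_def by blast
qed

lemma follows_path_limit:
  assumes P: "infinite P" and p: "follows (path P) p" "p \<in> sphere 0 1" and "0 < e"
  shows "\<exists>f\<in>words. f 0 \<noteq> p \<and> dist (f 0) p < e"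
proof -
  have "0 \<in> barrier_hull" unfolding barrier_hull_def by simp
  then obtain i where "dist (fwd (path P) (Suc i) 0) p < e" using hull_shrinks[OF P p \<open>0 < e\<close>] by blast
  moreover have "norm (fwd (path P) (Suc i) 0) < 1"
    by (rule unit_disc_moebius_norm(3)[OF words_moebius[OF fwd_words]]) simp
  then have "fwd (path P) (Suc i) 0 \<noteq> p" using p(2) by (metis less_irrefl mem_sphere_0)
  ultimately show ?thesis using fwd_words by blast
qed

section \<open>Uncountably many itineraries\<close>

text \<open>
  The gaps between the squares grow, and doubling them leaves room for one bit of information each.
\<close>
definition turns :: "nat set \<Rightarrow> nat set" where
  "turns A = range (\<lambda>i. 2 * i\<^sup>2 + of_bool (i \<in> A))"

lemma inj_turns: "inj turns"
proof (rule injI)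
  have mem: "i \<in> A \<longleftrightarrow> 2 * i\<^sup>2 + 1 \<in> turns A" for i A
  proof
    assume "2 * i\<^sup>2 + 1 \<in> turns A"
    then obtain j where j: "2 * i\<^sup>2 + 1 = 2 * j\<^sup>2 + of_bool (j \<in> A)" unfolding turns_def by auto
    \<comment> \<open>By parity.\<close>
    then have "j \<in> A" by (cases "j \<in> A") (auto, presburger)
    then have "i\<^sup>2 = j\<^sup>2" using j by simp
    then show "i \<in> A" using \<open>j \<in> A\<close> by (simp add: power2_eq_iff_nonneg)
  qed (auto simp: turns_def intro!: range_eqI[of _ _ i])
  fix A B assume "turns A = turns B"
  then show "A = B" using mem by blast
qed

lemma infinite_turns: "infinite (turns A)"
  unfolding infinite_nat_iff_unbounded_le
proof
  fix m :: nat
  have "m \<le> m\<^sup>2" by (simp add: power2_eq_square)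
  then have "m \<le> 2 * m\<^sup>2 + of_bool (m \<in> A)" by linarith
  then show "\<exists>n\<ge>m. n \<in> turns A" unfolding turns_def by blast
qed

lemma sparse_turns: "sparse (turns A)"
  unfolding sparse_def
proof
  fix N
  let ?g = "\<lambda>i. 2 * i\<^sup>2 + of_bool (i \<in> A) :: nat"
  have "{a \<in> turns A. \<exists>b\<in>turns A. a < b \<and> b \<le> a + N} \<subseteq> ?g ` {..N}"
  proof
    fix a assume "a \<in> {a \<in> turns A. \<exists>b\<in>turns A. a < b \<and> b \<le> a + N}"
    then obtain i j where ij: "a = ?g i" "?g i < ?g j" "?g j \<le> ?g i + N" unfolding turns_def by auto
    have "i < j"
    proof (rule ccontr)
      assume "\<not> i < j"
      then have "j = i \<or> j < i" by auto
      then show False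
      proof
        assume "j < i"
        then have "(Suc j)\<^sup>2 \<le> i\<^sup>2" by (intro power_mono) auto
        then have "2 * j\<^sup>2 + 2 \<le> 2 * i\<^sup>2" by (simp add: power2_eq_square)
        moreover have "of_bool (j \<in> A) \<le> (1::nat)" by simp
        ultimately show False using ij(2) by linarith
      qed (use ij(2) in simp)
    qed
    then have "(Suc i)\<^sup>2 \<le> j\<^sup>2" by (intro power_mono) auto
    then have "2 * i\<^sup>2 + 4 * i + 2 \<le> 2 * j\<^sup>2" by (simp add: power2_eq_square)
    moreover have "of_bool (i \<in> A) \<le> (1::nat)" by simp
    ultimately have "i \<le> N" using ij(3) by linarith
    then show "a \<in> ?g ` {..N}" using ij(1) by blast
  qed
  then show "finite {a \<in> turns A. \<exists>b\<in>turns A. a < b \<and> b \<le> a + N}"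
    by (rule finite_subset) simp
qed

lemma uncountable_follows:
  assumes "\<And>P p. infinite P \<Longrightarrow> sparse P \<Longrightarrow> follows (path P) p \<Longrightarrow> p \<in> sphere 0 1 \<Longrightarrow> p \<in> S"
  shows "uncountable S"
proof
  assume "countable S"
  define f where "f A = (SOME p. follows (path (turns A)) p \<and> p \<in> sphere 0 1)" for A
  have f: "follows (path (turns A)) (f A)" "f A \<in> sphere 0 1" for A
  proof -
    have "\<exists>p. follows (path (turns A)) p \<and> p \<in> sphere 0 1" using follows_path_exists by blast
    from someI_ex[OF this] show "follows (path (turns A)) (f A)" "f A \<in> sphere 0 1" unfolding f_def by auto
  qed
  have "inj f"
  proof (rule injI)
    fix A B assume "f A = f B"
    then have "path (turns A) = path (turns B)" using f(1) follows_inj by metis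
    then have eq: "path (turns A) j = path (turns B) j" for j by simp
    have "j \<in> turns A \<longleftrightarrow> j \<in> turns B" for j
      using eq[of j] by (cases "j \<in> turns A"; cases "j \<in> turns B") (simp_all add: path_def)
    then have "turns A = turns B" by blast
    then show "A = B" using inj_turns by (simp add: inj_eq)
  qed
  moreover have "range f \<subseteq> S" using f assms[OF infinite_turns sparse_turns] by blast
  then have "countable (range f)" using \<open>countable S\<close> countable_subset by blast
  ultimately have "countable (UNIV :: nat set set)" using countable_image_inj_on by blast
  then have "range (from_nat_into (UNIV :: nat set set)) = Pow UNIV"
    unfolding Pow_UNIV by (intro range_from_nat_into) simp_all
  then show False using Cantors_theorem[of "UNIV :: nat set"] by blast
qed

end

text \<open>
  The abstract group consists of maps restricted to the closed disc, the words are compositions of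
  total maps; on the closed disc both describe the same transformations.
\<close>
lemma generate_words:
  assumes "schottky s s' t t' u v"
    and g: "g \<in> Bij (cball 0 1)" "\<And>z. z \<in> cball 0 1 \<Longrightarrow> g z = translation (of_real u) z"
    and h: "h \<in> Bij (cball 0 1)" "\<And>z. z \<in> cball 0 1 \<Longrightarrow> h z = translation (of_real v * \<i>) z"
  defines "\<Gamma> \<equiv> generate (BijGroup (cball 0 1)) {g, h}"
  shows "\<gamma> \<in> \<Gamma> \<Longrightarrow> \<exists>f \<in> ping_pong.words (schottky.\<phi> u v). \<forall>z\<in>cball 0 1. \<gamma> z = f z"
    and "f \<in> ping_pong.words (schottky.\<phi> u v) \<Longrightarrow> \<exists>\<gamma>\<in>\<Gamma>. \<forall>z\<in>cball 0 1. \<gamma> z = f z"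
proof -
  interpret schottky s s' t t' u v by fact
  let ?X = "cball 0 1 :: complex set"
  let ?G = "BijGroup ?X"
  have carrier: "carrier ?G = Bij ?X" by (simp add: BijGroup_def)
  have gh: "{g, h} \<subseteq> carrier ?G" using g h carrier by simp
  have in_Bij: "\<gamma> \<in> Bij ?X" if "\<gamma> \<in> \<Gamma>" for \<gamma>
    using group.generate_in_carrier[OF group_BijGroup gh that[unfolded \<Gamma>_def]] carrier by simp
  have mult: "(\<gamma>1 \<otimes>\<^bsub>?G\<^esub> \<gamma>2) z = \<gamma>1 (\<gamma>2 z)" if "\<gamma>1 \<in> Bij ?X" "\<gamma>2 \<in> Bij ?X" "z \<in> ?X" for \<gamma>1 \<gamma>2 z
    using that by (simp add: BijGroup_def compose_def)
  have gen: "\<gamma> z = \<phi> c z" if "(\<gamma>, c) \<in> {(g, Lg), (h, Lh)}" "z \<in> ?X" for \<gamma> c z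
    using that g(2) h(2) by (auto simp: \<phi>_def)
  have inv: "(inv\<^bsub>?G\<^esub> \<gamma>) z = \<phi> (opp c) z" if gc: "(\<gamma>, c) \<in> {(g, Lg), (h, Lh)}" and z: "z \<in> ?X" for \<gamma> c z
  proof -
    have \<gamma>: "\<gamma> \<in> Bij ?X" using gc g h by auto
    have y: "\<phi> (opp c) z \<in> ?X" using phi_cball[OF z] .
    have "\<gamma> (\<phi> (opp c) z) = z" using gen[OF gc y] opp_inverse'[OF z] by simp
    moreover have "inj_on \<gamma> ?X" using \<gamma> unfolding Bij_def bij_betw_def by simp
    ultimately have "inv_into ?X \<gamma> z = \<phi> (opp c) z" using y by (metis inv_into_f_eq)
    then show ?thesis using inv_BijGroup[OF \<gamma>] z by simp
  qed
  show "\<exists>f \<in> words. \<forall>z\<in>?X. \<gamma> z = f z" if "\<gamma> \<in> \<Gamma>"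
    using that unfolding \<Gamma>_def
  proof (induction rule: generate.induct)
    case one
    have "\<forall>z\<in>?X. \<one>\<^bsub>?G\<^esub> z = id z" by (simp add: BijGroup_def)
    then show ?case using words.empty by blast
  next
    case (incl \<gamma>)
    then obtain c where "(\<gamma>, c) \<in> {(g, Lg), (h, Lh)}" by blast
    then show ?case using gen letter_words by blast
  next
    case (inv \<gamma>)
    then obtain c where "(\<gamma>, c) \<in> {(g, Lg), (h, Lh)}" by blast
    then show ?case using \<open>\<And>z c \<gamma>. (\<gamma>, c) \<in> {(g, Lg), (h, Lh)} \<Longrightarrow> z \<in> ?X \<Longrightarrow> (inv\<^bsub>?G\<^esub> \<gamma>) z = \<phi> (opp c) z\<close> letter_words by blast
  next
    case (eng \<gamma>1 \<gamma>2)
    then obtain f1 f2 where f: "f1 \<in> words" "f2 \<in> words" "\<forall>z\<in>?X. \<gamma>1 z = f1 z" "\<forall>z\<in>?X. \<gamma>2 z = f2 z" by blast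
    have B: "\<gamma>1 \<in> Bij ?X" "\<gamma>2 \<in> Bij ?X" using eng.hyps in_Bij unfolding \<Gamma>_def by blast+
    have "\<forall>z\<in>?X. (\<gamma>1 \<otimes>\<^bsub>?G\<^esub> \<gamma>2) z = (f1 \<circ> f2) z"
    proof
      fix z assume z: "z \<in> ?X"
      have "f2 z \<in> ?X" using words_maps_to[OF f(2) z] .
      then show "(\<gamma>1 \<otimes>\<^bsub>?G\<^esub> \<gamma>2) z = (f1 \<circ> f2) z" using mult[OF B z] f(3,4) z by simp
    qed
    then show ?case using comp_words[OF f(1,2)] by blast
  qed
  have letter: "\<exists>\<gamma>\<in>\<Gamma>. \<forall>z\<in>?X. \<gamma> z = \<phi> c z" for c
  proof -
    obtain \<gamma> d where d: "(\<gamma>, d) \<in> {(g, Lg), (h, Lh)}" "c = d \<or> c = opp d"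
      using that[of g Lg] that[of h Lh] by (cases c) simp_all
    have "\<gamma> \<in> {g, h}" using d(1) by auto
    then have "\<gamma> \<in> \<Gamma>" "inv\<^bsub>?G\<^esub> \<gamma> \<in> \<Gamma>" unfolding \<Gamma>_def by (auto intro: generate.intros)
    moreover have "\<forall>z\<in>?X. \<gamma> z = \<phi> d z" "\<forall>z\<in>?X. (inv\<^bsub>?G\<^esub> \<gamma>) z = \<phi> (opp d) z"
      using gen[OF d(1)] inv[OF d(1)] by blast+
    ultimately show ?thesis using d(2) by metis
  qed
  show "\<exists>\<gamma>\<in>\<Gamma>. \<forall>z\<in>?X. \<gamma> z = f z" if "f \<in> words"
    using that
  proof (induction rule: words.induct)
    case empty
    have "\<one>\<^bsub>?G\<^esub> \<in> \<Gamma>" unfolding \<Gamma>_def by (rule generate.one)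
    moreover have "\<forall>z\<in>?X. \<one>\<^bsub>?G\<^esub> z = id z" by (simp add: BijGroup_def)
    ultimately show ?case by blast
  next
    case (letter f c)
    from letter.IH obtain \<gamma> where \<gamma>: "\<gamma> \<in> \<Gamma>" "\<forall>z\<in>?X. \<gamma> z = f z" by blast
    obtain \<gamma>1 where \<gamma>1: "\<gamma>1 \<in> \<Gamma>" "\<forall>z\<in>?X. \<gamma>1 z = \<phi> c z" using \<open>\<And>c. \<exists>\<gamma>\<in>\<Gamma>. \<forall>z\<in>?X. \<gamma> z = \<phi> c z\<close> by blast
    have "\<forall>z\<in>?X. (\<gamma>1 \<otimes>\<^bsub>?G\<^esub> \<gamma>) z = (\<phi> c \<circ> f) z"
    proof
      fix z assume z: "z \<in> ?X"
      have "f z \<in> ?X" using words_maps_to[OF letter.hyps z] .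
      then show "(\<gamma>1 \<otimes>\<^bsub>?G\<^esub> \<gamma>) z = (\<phi> c \<circ> f) z"
        using mult[OF in_Bij[OF \<gamma>1(1)] in_Bij[OF \<gamma>(1)] z] \<gamma>1(2) \<gamma>(2) z by simp
    qed
    moreover have "\<gamma>1 \<otimes>\<^bsub>?G\<^esub> \<gamma> \<in> \<Gamma>" using \<gamma>(1) \<gamma>1(1) unfolding \<Gamma>_def by (rule generate.eng[rotated])
    ultimately show ?case by blast
  qed
qed

lemma translation_Bij:
  assumes \<beta>: "norm \<beta> < 1" and f: "f \<in> disc_moebius" "\<And>z. z \<in> cball 0 1 \<Longrightarrow> f z = translation \<beta> z"
  shows "f \<in> Bij (cball 0 1)"
proof -
  have maps: "translation b z \<in> cball 0 1" if "norm b < 1" "z \<in> cball 0 1" for b z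
    using unit_disc_moebius_norm(1)[OF translation_moebius[OF that(1)], of z] that(2) by simp
  have "bij_betw (translation \<beta>) (cball 0 1) (cball 0 1)"
    using maps[OF \<beta>] maps[of "- \<beta>"] translation_inverse[OF \<beta>] translation_inverse[of "- \<beta>"] \<beta>
    by (intro bij_betwI[where g = "translation (- \<beta>)"]) auto
  then have "bij_betw f (cball 0 1) (cball 0 1)"
    using bij_betw_cong[of "cball 0 1" f "translation \<beta>" "cball 0 1"] f(2) by blast
  moreover have "f \<in> extensional (cball 0 1)" using f(1) unfolding disc_moebius_def by auto
  ultimately show ?thesis unfolding Bij_def by simp
qed

lemma disjoint_geodesics_separated:
  fixes s t :: real
  assumes "1 < \<bar>s\<bar>" "1 < \<bar>t\<bar>"
    and "disjnt (closure (geodesic_arc (of_real s))) (closure (geodesic_arc (\<i> * of_real t)))"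
  shows "1 < (1/s)\<^sup>2 + (1/t)\<^sup>2"
proof -
  let ?z = "Complex (1/s) (1/t)"
  have nz: "s \<noteq> 0" "t \<noteq> 0" using assms(1,2) by auto
  have "1 < norm (complex_of_real s)" "1 < norm (\<i> * complex_of_real t)"
    using assms(1,2) by (simp_all add: norm_mult)
  moreover have "Re (cnj (of_real s) * ?z) = 1" "Re (cnj (\<i> * of_real t) * ?z) = 1" using nz by simp_all
  ultimately have "1 < norm ?z" using disjoint_arcs_imp[OF _ _ assms(3)] by blast
  then have "1\<^sup>2 < (norm ?z)\<^sup>2" by (intro power_strict_mono) auto
  then show ?thesis by (simp add: cmod_power2)
qed

theorem theorem4p3:
  fixes s s' t t' :: real
    and a a' b b' R :: "complex set"
    and g h :: "complex \<Rightarrow> complex"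
    and \<Gamma>\<^sub>0 :: "(complex \<Rightarrow> complex) set"
  assumes centers: "\<bar>s\<bar> > 1" "\<bar>s'\<bar> > 1" "\<bar>t\<bar> > 1" "\<bar>t'\<bar> > 1"
    and opposite_sides: "s * s' < 0" "t * t' < 0"
    and arcs: "a = geodesic_arc (complex_of_real s)" "a' = geodesic_arc (complex_of_real s')"
      "b = geodesic_arc (\<i> * complex_of_real t)" "b' = geodesic_arc (\<i> * complex_of_real t')"
    and disjoint_closures:
      "disjnt (closure a) (closure a')" "disjnt (closure a) (closure b)"
      "disjnt (closure a) (closure b')" "disjnt (closure a') (closure b)"
      "disjnt (closure a') (closure b')" "disjnt (closure b) (closure b')"
    and region: "R = connected_component_set (ball 0 1 - (a \<union> a' \<union> b \<union> b')) 0"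
      "top_of_set (ball 0 1) frontier_of R = a \<union> a' \<union> b \<union> b'"
    and g: "hyperbolic g" "g ` {z \<in> ball 0 1. Im z = 0} = {z \<in> ball 0 1. Im z = 0}" "g ` a' = a"
    and h: "hyperbolic h" "h ` {z \<in> ball 0 1. Re z = 0} = {z \<in> ball 0 1. Re z = 0}" "h ` b' = b"
    and group: "\<Gamma>\<^sub>0 = generate (BijGroup (cball 0 1)) {g, h}"
  shows "uncountable {p \<in> limit_set \<Gamma>\<^sub>0. \<not> concentration_point \<Gamma>\<^sub>0 p}"
proof -
  have "g ` {z \<in> ball 0 1. Im (cnj 1 * z) = 0} = {z \<in> ball 0 1. Im (cnj 1 * z) = 0}" using g(2) by simp
  then obtain u where u: "\<bar>u\<bar> < 1" "\<And>z. z \<in> cball 0 1 \<Longrightarrow> g z = translation (of_real u * 1) z"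
    using hyperbolic_preserving_diameter[OF g(1), of 1] by (metis norm_one)
  have "h ` {z \<in> ball 0 1. Im (cnj \<i> * z) = 0} = {z \<in> ball 0 1. Im (cnj \<i> * z) = 0}" using h(2) by simp
  then obtain v where v: "\<bar>v\<bar> < 1" "\<And>z. z \<in> cball 0 1 \<Longrightarrow> h z = translation (of_real v * \<i>) z"
    using hyperbolic_preserving_diameter[OF h(1), of \<i>] by (metis norm_ii)
  have arc_disc: "z \<in> cball 0 1" if "z \<in> geodesic_arc c" for z c using that unfolding geodesic_arc_def by auto
  have "translation (of_real u * 1) z \<in> geodesic_arc (of_real s * 1)" if "z \<in> geodesic_arc (of_real s' * 1)" for z
    using imageI[of z a' g] that u(2)[OF arc_disc[OF that]] unfolding g(3) unfolding arcs by simp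
  then have pair_g: "s' * (1 + u\<^sup>2 - 2 * s * u) = s * (1 + u\<^sup>2) - 2 * u"
    by (intro pairing_equation[OF u(1) centers(1,2) norm_one])
  have "translation (of_real v * \<i>) z \<in> geodesic_arc (of_real t * \<i>)" if "z \<in> geodesic_arc (of_real t' * \<i>)" for z
    using imageI[of z b' h] that v(2)[OF arc_disc[OF that]] unfolding h(3) unfolding arcs
    by (simp add: mult.commute)
  then have pair_h: "t' * (1 + v\<^sup>2 - 2 * t * v) = t * (1 + v\<^sup>2) - 2 * v"
    by (intro pairing_equation[OF v(1) centers(3,4) norm_ii])
  have "1 < (1/s)\<^sup>2 + (1/t)\<^sup>2" "1 < (1/s)\<^sup>2 + (1/t')\<^sup>2" "1 < (1/s')\<^sup>2 + (1/t)\<^sup>2" "1 < (1/s')\<^sup>2 + (1/t')\<^sup>2"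
    using disjoint_closures(2-5) centers unfolding arcs by (simp_all only: disjoint_geodesics_separated)
  then have schottky: "schottky s s' t t' u v"
    using centers opposite_sides u(1) v(1) pair_g pair_h by (intro schottky.intro)
  interpret schottky s s' t t' u v by (rule schottky)
  have "norm (of_real u :: complex) < 1" "norm (of_real v * \<i>) < 1" using u(1) v(1) by (simp_all add: norm_mult)
  then have Bij: "g \<in> Bij (cball 0 1)" "h \<in> Bij (cball 0 1)"
    using translation_Bij[of "of_real u" g] translation_Bij[of "of_real v * \<i>" h] u(2) v(2) g(1) h(1)
    unfolding hyperbolic_def by simp_all
  note generate = generate_words[OF schottky Bij(1) _ Bij(2) v(2), folded group]
  have to_words: "\<exists>f\<in>words. \<forall>z\<in>cball 0 1. \<gamma> z = f z" if "\<gamma> \<in> \<Gamma>\<^sub>0" for \<gamma>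
    using generate(1)[OF _ _ that] u(2) by simp
  have from_words: "\<exists>\<gamma>\<in>\<Gamma>\<^sub>0. \<forall>z\<in>cball 0 1. \<gamma> z = f z" if "f \<in> words" for f
    using generate(2)[OF _ _ that] u(2) by simp
  show ?thesis
  proof (rule uncountable_follows, intro CollectI conjI)
    fix P p assume P: "infinite P" "sparse P" and p: "follows (path P) p" "p \<in> sphere 0 1"
    have "p islimpt (\<lambda>\<gamma>. \<gamma> 0) ` \<Gamma>\<^sub>0"
      unfolding islimpt_approachable
    proof (intro allI impI)
      fix e :: real assume "0 < e"
      then obtain f where f: "f \<in> words" "f 0 \<noteq> p" "dist (f 0) p < e"
        using follows_path_limit[OF P(1) p] by blast
      obtain \<gamma> where "\<gamma> \<in> \<Gamma>\<^sub>0" "\<gamma> 0 = f 0" using from_words[OF f(1)] by force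
      then show "\<exists>x'\<in>(\<lambda>\<gamma>. \<gamma> 0) ` \<Gamma>\<^sub>0. x' \<noteq> p \<and> dist x' p < e" using f(2,3) by (metis image_eqI)
    qed
    then show "p \<in> limit_set \<Gamma>\<^sub>0" unfolding limit_set_def using p(2) by (auto intro!: bexI[of _ 0])
    show "\<not> concentration_point \<Gamma>\<^sub>0 p"
    proof
      assume "concentration_point \<Gamma>\<^sub>0 p"
      then obtain W where W: "open_in_circle W" "p \<in> W"
        "\<And>U. open_in_circle U \<Longrightarrow> connected U \<Longrightarrow> p \<in> U \<Longrightarrow> U \<subseteq> W \<Longrightarrow> can_be_concentrated_at \<Gamma>\<^sub>0 U p"
        unfolding concentration_point_def by blast
      obtain U V where UV: "open_in_circle U" "connected U" "p \<in> U" "U \<subseteq> W" "open_in_circle V" "p \<in> V"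
        and no: "\<And>\<gamma>. \<gamma> \<in> words \<Longrightarrow> p \<in> \<gamma> ` U \<Longrightarrow> \<not> \<gamma> ` U \<subseteq> V"
        using not_concentrated[OF P p W(1,2)] by blast
      obtain \<gamma> where \<gamma>: "\<gamma> \<in> \<Gamma>\<^sub>0" "p \<in> \<gamma> ` U" "\<gamma> ` U \<subseteq> V"
        using W(3)[OF UV(1-4)] UV(5,6) unfolding can_be_concentrated_at_def by blast
      obtain f where f: "f \<in> words" "\<forall>z\<in>cball 0 1. \<gamma> z = f z" using to_words[OF \<gamma>(1)] by blast
      have "U \<subseteq> cball 0 1" using openin_imp_subset[OF UV(1)] by auto
      then have "f ` U = \<gamma> ` U" using f(2) by (intro image_cong) auto
      then show False using no[OF f(1)] \<gamma>(2,3) by simp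
    qed
  qed
qed

end
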